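(* Let $a,b$ be positive integers with $2\nmid ab$. Let $p$ be an odd prime such that $p\neq a$, $p\neq b$, $p\nmid ab+1$ and $p=ax^2+by^2$ with $x,y\in\mathbb{Z}$. Let $n=((ab+1)p-a-b)/8$. Then $$(-1)^{\frac{a+b}{2}x+\frac{b+1}{2}}(4ax^2-2p)=\lambda(a,b;n+1)=\sum_{k_1+2k_2+\cdots+nk_n=n}(-3)^{k_1+\cdots+k_n}\frac{\left(a\sigma(\frac1a)+b\sigma(\frac1b)\right)^{k_1}\cdots\left(a\sigma(\frac na)+b\sigma(\frac nb)\right)^{k_n}}{1^{k_1}\cdot k_1!\cdots n^{k_n}\cdot k_n!}.$$
   Context: For positive integers $a,b,n$, $\lambda(a,b;n)$ is the integer defined by the power series expansion $q\prod_{k=1}^{\infty}(1-q^{ak})^3(1-q^{bk})^3=\sum_{n=1}^{\infty}\lambda(a,b;n)q^n$ for $|q|<1$. For a rational number $m$, $\sigma(m)=\sum_{d\mid m}d$ (sum over positive divisors $d$ of $m$) if $m$ is a positive integer, and $\sigma(m)=0$ otherwise. The sum runs over all $n$-tuples $(k_1,\ldots,k_n)$ of nonnegative integers with $k_1+2k_2+\cdots+nk_n=n$, with the convention $0^0=1$. *)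

theory Defs
  imports "HOL-Analysis.Analysis" "HOL-Computational_Algebra.Primes"
begin

text \<open>
  The coefficients of q times the product over all positive k of
  (1 - q^(ak))^3 (1 - q^(bk))^3, as the integer sequence whose power series represents this
  function on the open unit disc of the complex plane. The clause \<open>c 0 = 0\<close> pins the
  constant coefficient (the expansion starts at q^1), and \<open>prodinf\<close> is indexed from 0,
  whence \<open>Suc k\<close>. Only meaningful for positive \<open>a\<close> and \<open>b\<close>.
\<close>

definition lambda_coeff :: "nat \<Rightarrow> nat \<Rightarrow> nat \<Rightarrow> int" where
  "lambda_coeff a b = (THE c. c 0 = 0 \<and>
     (\<forall>q::complex. norm q < 1 \<longrightarrow>
        (\<lambda>n. of_int (c n) * q ^ n) sums
          (q * (\<Prod>k. (1 - q ^ (a * Suc k)) ^ 3 * (1 - q ^ (b * Suc k)) ^ 3))))"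

definition sigma_rat :: "rat \<Rightarrow> nat" where
  "sigma_rat m = (if m \<in> \<int> \<and> m > 0 then \<Sum>{d::nat. d dvd nat \<lfloor>m\<rfloor>} else 0)"

text \<open>
  The tuples \<open>(k 1, \<dots>, k n)\<close> of natural numbers with k_1 + 2 k_2 + ... + n k_n = n, as
  functions on \<open>{1..n}\<close>; extensionality makes functions and tuples correspond one to one.
\<close>

definition weighted_tuples :: "nat \<Rightarrow> (nat \<Rightarrow> nat) set" where
  "weighted_tuples n = {k \<in> {1..n} \<rightarrow>\<^sub>E UNIV. (\<Sum>i=1..n. i * k i) = n}"

text \<open>
  Under the hypotheses on \<open>a\<close>, \<open>b\<close>, \<open>p\<close> the number ((ab+1)p - a - b)/8 is a natural number,
  so a natural number \<open>n\<close> may be equated with it without loss.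
\<close>

lemma index_is_nat:
  fixes a b p :: nat and x y :: int
  assumes "odd (a * b)" and "odd p" and p: "int p = int a * x\<^sup>2 + int b * y\<^sup>2"
  shows "\<exists>!n::nat. rat_of_nat n = ((of_nat a * of_nat b + 1) * of_nat p - of_nat a - of_nat b) / 8"
proof -
  have odd_ab: "odd (int a)" "odd (int b)" using assms(1) by simp_all
  have sq8: "8 dvd z\<^sup>2 - 1" if "odd z" for z :: int
  proof -
    obtain w where w: "z = 2 * w + 1" using \<open>odd z\<close> by (rule oddE)
    have "even (w * (w + 1))" by simp
    then obtain v where "w * (w + 1) = 2 * v" by (rule evenE)
    then have "z\<^sup>2 - 1 = 8 * v" unfolding w power2_eq_square by (simp add: algebra_simps)
    then show ?thesis by simp
  qed
  have key: "8 dvd (c * d + 1) * (c * u\<^sup>2 + d * v\<^sup>2) - c - d"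
    if "odd c" "odd d" "odd u" "even v" for c d u v :: int
  proof -
    obtain r where r: "u\<^sup>2 - 1 = 8 * r" using sq8[OF \<open>odd u\<close>] by (rule dvdE)
    obtain s where s: "c\<^sup>2 - 1 = 8 * s" using sq8[OF \<open>odd c\<close>] by (rule dvdE)
    obtain t where t: "v = 2 * t" using \<open>even v\<close> by (rule evenE)
    have "even (c * d + 1)" using that by simp
    then obtain m where m: "c * d + 1 = 2 * m" by (rule evenE)
    have e: "(c * d + 1) * d * v\<^sup>2 = 8 * (m * d * t\<^sup>2)"
      unfolding m t by (simp add: power2_eq_square)
    have "(c * d + 1) * (c * u\<^sup>2 + d * v\<^sup>2) - c - d
        = (c * d + 1) * c * (u\<^sup>2 - 1) + d * (c\<^sup>2 - 1) + (c * d + 1) * d * v\<^sup>2"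
      by (simp add: algebra_simps power2_eq_square)
    also have "\<dots> = 8 * ((c * d + 1) * c * r + d * s + m * d * t\<^sup>2)"
      unfolding r s e by (simp add: algebra_simps)
    finally show ?thesis by simp
  qed
  have "odd (int p)" using assms(2) by simp
  then have "odd x \<noteq> odd y" using odd_ab unfolding p by auto
  then have "8 dvd (int a * int b + 1) * int p - int a - int b"
    using key[of "int a" "int b" x y] key[of "int b" "int a" y x] odd_ab unfolding p
    by (auto simp: algebra_simps)
  then obtain N where N: "(int a * int b + 1) * int p - int a - int b = 8 * N" by (rule dvdE)
  have ge: "(c * d + 1) * (c * u\<^sup>2 + d * v\<^sup>2) \<ge> c + d"
    if "c \<ge> 1" "d \<ge> 1" "u \<noteq> 0" for c d u v :: int
  proof -
    have "u\<^sup>2 \<ge> 1" using that(3) by (simp add: int_one_le_iff_zero_less)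
    then have "c * 1 \<le> c * u\<^sup>2" using that(1) by (intro mult_left_mono) auto
    moreover have "0 \<le> d * v\<^sup>2" using that(2) by simp
    ultimately have "c \<le> c * u\<^sup>2 + d * v\<^sup>2" by linarith
    then have "(c * d + 1) * c \<le> (c * d + 1) * (c * u\<^sup>2 + d * v\<^sup>2)"
      using \<open>c \<ge> 1\<close> \<open>d \<ge> 1\<close> by (intro mult_left_mono) auto
    moreover have "1 * d \<le> (c * c) * d"
      using that mult_mono[of 1 c 1 c] by (intro mult_right_mono) auto
    ultimately show ?thesis by (simp add: algebra_simps)
  qed
  have pos: "int a \<ge> 1" "int b \<ge> 1" using odd_pos[of a] odd_pos[of b] assms(1) by simp_all
  have "x \<noteq> 0 \<or> y \<noteq> 0" using \<open>odd x \<noteq> odd y\<close> by auto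
  then have "int a + int b \<le> (int a * int b + 1) * int p"
    using ge[of "int a" "int b" x y] ge[of "int b" "int a" y x] pos unfolding p
    by (auto simp: algebra_simps)
  with N have "N \<ge> 0" by linarith
  then obtain n where n: "N = int n" by (rule nonneg_int_cases)
  have "rat_of_int ((int a * int b + 1) * int p - int a - int b) = rat_of_int (8 * N)"
    by (simp only: N)
  then have "rat_of_nat n = ((of_nat a * of_nat b + 1) * of_nat p - of_nat a - of_nat b) / 8"
    by (simp add: n)
  then show ?thesis by (metis of_nat_eq_iff)
qed

end

theory Submission
  imports Defs "HOL-Complex_Analysis.Complex_Analysis"
begin

text \<open>
  Write \<open>T(j) = j(j+1)/2\<close>, which appears below as \<open>Suc j choose 2\<close>. Jacobi's identity expands
  the cube of Euler's product as the sum of \<open>(-1)\<^sup>j (2j+1) q\<^bsup>T(j)\<^esup>\<close>. Applying it with \<open>q\<^sup>a\<close> and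
  with \<open>q\<^sup>b\<close> in the place of \<open>q\<close> shows that \<open>\<lambda>(a,b;n+1)\<close> is the sum of
  \<open>(-1)\<^bsup>j+k\<^esup> (2j+1)(2k+1)\<close> over all pairs with \<open>a T(j) + b T(k) = n\<close>. Since
  \<open>8 T(j) + 1 = (2j+1)\<^sup>2\<close>, this condition says that \<open>X = 2j+1\<close> and \<open>Y = 2k+1\<close> are positive odd integers with
  \<open>a X\<^sup>2 + b Y\<^sup>2 = 8n + a + b\<close>.

  For the \<open>n\<close> of the theorem the right-hand side is \<open>(ab+1)p\<close>, and Brahmagupta's identity turns
  \<open>p = a x\<^sup>2 + b y\<^sup>2\<close> into the two solutions \<open>(|x - by|, |ax + y|)\<close> and \<open>(|x + by|, |ax - y|)\<close>.
  They are distinct, and primality of \<open>p\<close> leaves room for no others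
  (\<open>representation_of_multiple\<close>). Up to a common sign the two terms are
  \<open>(x - by)(ax + y)\<close> and \<open>(x + by)(ax - y)\<close>, whose sum is \<open>2ax\<^sup>2 - 2by\<^sup>2 = 4ax\<^sup>2 - 2p\<close>; the sign
  depends only on residues modulo 4. This is the first equation.

  The second equation holds for every \<open>n\<close>. The logarithmic derivative \<open>q P'/P\<close> of the product \<open>P\<close>
  has the coefficients \<open>-3 (a \<sigma>(m/a) + b \<sigma>(m/b))\<close>, so comparing coefficients in
  \<open>q P' = P \<cdot> (q P'/P)\<close> gives a recurrence that determines \<open>P\<close> from its constant term. The sum over
  tuples consists of the coefficients of the exponential of the series with the terms
  \<open>-3 (a \<sigma>(m/a) + b \<sigma>(m/b)) q\<^sup>m / m\<close> and satisfies the same recurrence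
  (\<open>eta_product_recurrence\<close>, \<open>sum_exp_term_recurrence\<close>).

  Jacobi's identity is obtained from a finite version (\<open>finite_jacobi\<close>), which is the derivative of
  the \<open>q\<close>-binomial theorem at a zero of the product. The algebra takes place with finite products,
  whose coefficients are found by congruences modulo powers of \<open>q\<close>; analysis enters only in \<open>eta_product_sums\<close>, which identifies the stable
  coefficients of the finite products with the power series of the infinite product.
\<close>

section \<open>The \<open>q\<close>-binomial theorem\<close>

definition qfact :: "'a::comm_ring_1 \<Rightarrow> nat \<Rightarrow> 'a" where
  "qfact q n = (\<Prod>k=1..n. 1 - q ^ k)"

lemma qfact_0 [simp]: "qfact q 0 = 1"
  by (simp add: qfact_def)

lemma qfact_Suc [simp]: "qfact q (Suc n) = qfact q n * (1 - q ^ Suc n)"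
  by (simp add: qfact_def)

text \<open>
  Defining the Gaussian binomial coefficients by a Pascal rule instead of as a quotient of
  products keeps them meaningful in every commutative ring.
\<close>
fun qbinomial :: "'a::comm_ring_1 \<Rightarrow> nat \<Rightarrow> nat \<Rightarrow> 'a" where
  "qbinomial q n 0 = 1"
| "qbinomial q 0 (Suc k) = 0"
| "qbinomial q (Suc n) (Suc k) = qbinomial q n k + q ^ Suc k * qbinomial q n (Suc k)"

lemma qbinomial_eq_0: "n < k \<Longrightarrow> qbinomial q n k = 0"
  by (induction q n k rule: qbinomial.induct) auto

lemma qbinomial_self [simp]: "qbinomial q n n = 1"
  by (induction n) (auto simp: qbinomial_eq_0)

lemma qbinomial_qfact:
  "k \<le> n \<Longrightarrow> qbinomial q n k * (qfact q k * qfact q (n - k)) = qfact q n"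
proof (induction q n k rule: qbinomial.induct)
  case (3 q n k)
  show ?case
  proof (cases "k = n")
    case True
    then show ?thesis by simp
  next
    case False
    with 3 have k: "Suc k \<le> n" by simp
    define d where "d = n - Suc k"
    have d: "n - k = Suc d" "n = Suc k + d" using k by (simp_all add: d_def)
    have IH1: "qbinomial q n k * (qfact q k * (qfact q d * (1 - q ^ Suc d))) = qfact q n"
      using 3 k by (simp add: d)
    have IH2: "qbinomial q n (Suc k) * (qfact q k * (1 - q ^ Suc k) * qfact q d) = qfact q n"
      using 3 k by (simp add: d)
    have "qbinomial q (Suc n) (Suc k) * (qfact q (Suc k) * qfact q (Suc n - Suc k))
      = (qbinomial q n k + q ^ Suc k * qbinomial q n (Suc k)) *
          (qfact q k * (1 - q ^ Suc k) * (qfact q d * (1 - q ^ Suc d)))"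
      by (simp only: diff_Suc_Suc d(1) qbinomial.simps qfact_Suc)
    also have "\<dots> = qbinomial q n k * (qfact q k * (qfact q d * (1 - q ^ Suc d))) * (1 - q ^ Suc k)
       + q ^ Suc k * (1 - q ^ Suc d) * (qbinomial q n (Suc k) * (qfact q k * (1 - q ^ Suc k) * qfact q d))"
      by (simp only: algebra_simps)
    also have "\<dots> = qfact q n * (1 - q ^ Suc k + q ^ Suc k * (1 - q ^ Suc d))"
      by (simp only: IH1 IH2) (simp only: algebra_simps)
    also have "1 - q ^ Suc k + q ^ Suc k * (1 - q ^ Suc d) = 1 - q ^ Suc n"
      by (simp add: d(2) algebra_simps power_add)
    finally show ?thesis by simp
  qed
qed auto

text \<open>
  Homogeneous version, as an identity of polynomials in an indeterminate \<open>z\<close>: the product of the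
  \<open>u + y q\<^sup>k z\<close>. The second variable \<open>u\<close> permits the choice \<open>u = q\<^sup>N\<close>, which stands for the negative
  power \<open>q\<^bsup>-N\<^esup>\<close> in the usual formulation. The induction splits off the factor with \<open>k = 0\<close>; the
  others form the same product for \<open>y q\<close>.
\<close>
theorem qbinomial_theorem:
  fixes q u :: "'a::comm_ring_1"
  shows "(\<Prod>k<n. [:u, y * q ^ k:])
       = (\<Sum>k\<le>n. monom (q ^ (k choose 2) * qbinomial q n k * y ^ k * u ^ (n - k)) k)"
proof (induction n arbitrary: y)
  case 0
  show ?case by (simp add: monom_0 one_pCons numeral_2_eq_2)
next
  case (Suc n)
  define c where "c k = q ^ (k choose 2) * qbinomial q n k * (y * q) ^ k * u ^ (n - k)" for k
  define e where "e k = q ^ (k choose 2) * qbinomial q (Suc n) k * y ^ k * u ^ (Suc n - k)" for k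
  have e0: "e 0 = u * c 0" by (simp add: c_def e_def numeral_2_eq_2)
  have eS: "e (Suc k) = u * c (Suc k) + y * c k" if "k \<le> n" for k
  proof (cases "k = n")
    case True
    then show ?thesis
      by (simp add: c_def e_def qbinomial_eq_0 numeral_2_eq_2 power_add algebra_simps)
  next
    case False
    then obtain d where d: "n = Suc (k + d)"
      using \<open>k \<le> n\<close> by (metis le_neq_implies_less less_imp_Suc_add)
    have "Suc n - Suc k = Suc d" "n - Suc k = d" "n - k = Suc d" by (simp_all add: d)
    then show ?thesis
      by (simp add: c_def e_def numeral_2_eq_2 power_add power_mult_distrib algebra_simps)
  qed
  (* The sum for n may be extended by this vanishing term before its index is shifted. *)
  have cS: "c (Suc n) = 0" by (simp add: c_def qbinomial_eq_0)
  have "(\<Prod>k<Suc n. [:u, y * q ^ k:]) = [:u, y:] * (\<Prod>k<n. [:u, (y * q) * q ^ k:])"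
    by (simp only: prod.lessThan_Suc_shift) (simp add: mult.assoc)
  also have "(\<Prod>k<n. [:u, (y * q) * q ^ k:]) = (\<Sum>k\<le>n. monom (c k) k)"
    unfolding c_def by (rule Suc.IH)
  also have "[:u, y:] * (\<Sum>k\<le>n. monom (c k) k)
      = (\<Sum>k\<le>n. monom (u * c k) k) + (\<Sum>k\<le>n. monom (y * c k) (Suc k))"
  proof -
    have "[:u, y:] * monom a k = monom (u * a) k + monom (y * a) (Suc k)" for a k
      by (simp add: smult_monom monom_Suc)
    then show ?thesis by (simp only: sum_distrib_left sum.distrib)
  qed
  also have "(\<Sum>k\<le>n. monom (u * c k) k) = (\<Sum>k\<le>Suc n. monom (u * c k) k)"
    by (simp add: cS)
  also have "\<dots> = monom (e 0) 0 + (\<Sum>k\<le>n. monom (u * c (Suc k)) (Suc k))"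
    by (simp only: sum.atMost_Suc_shift e0)
  also have "\<dots> + (\<Sum>k\<le>n. monom (y * c k) (Suc k))
      = monom (e 0) 0 + (\<Sum>k\<le>n. monom (e (Suc k)) (Suc k))"
  proof -
    have "(\<Sum>k\<le>n. monom (u * c (Suc k)) (Suc k)) + (\<Sum>k\<le>n. monom (y * c k) (Suc k))
        = (\<Sum>k\<le>n. monom (e (Suc k)) (Suc k))"
      unfolding sum.distrib[symmetric] by (rule sum.cong) (simp_all add: add_monom eS)
    then show ?thesis by (simp only: add.assoc)
  qed
  also have "\<dots> = (\<Sum>k\<le>Suc n. monom (e k) k)"
    by (simp only: sum.atMost_Suc_shift)
  finally show ?case by (simp only: e_def)
qed

section \<open>Jacobi's identity for the cube of Euler's product\<close>

lemma two_times_choose_two: "2 * int (n choose 2) = int n * (int n - 1)"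
proof -
  have "even (n * (n - 1))" by (cases n) auto
  then have "2 * (n choose 2) = n * (n - 1)" by (simp add: choose_two)
  then have "int (2 * (n choose 2)) = int (n * (n - 1))" by simp
  then show ?thesis by (cases n) (simp_all add: algebra_simps)
qed

text \<open>
  The exponents of \<open>q\<close> in the \<open>q\<close>-binomial theorem for \<open>2N + 1\<close> factors and \<open>u = q\<^sup>N\<close> are symmetric
  about the middle of the range of summation: up to a constant, the terms \<open>N - j\<close> and \<open>N + 1 + j\<close>
  both have the \<open>j\<close>-th triangular number as exponent.
\<close>
lemma theta_exponent:
  assumes "j \<le> N"
  shows "((N - j) choose 2) + N * (N + 1 + j) = (Suc j choose 2) + ((N choose 2) + N * N + N)"
    and "((N + 1 + j) choose 2) + N * (N - j) = (Suc j choose 2) + ((N choose 2) + N * N + N)"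
proof -
  have [simp]: "int (N - j) = int N - int j" using assms by simp
  have "2 * int (((N - j) choose 2) + N * (N + 1 + j))
      = 2 * int ((Suc j choose 2) + ((N choose 2) + N * N + N))"
    unfolding of_nat_add of_nat_mult distrib_left two_times_choose_two
    by (simp add: algebra_simps)
  then show "((N - j) choose 2) + N * (N + 1 + j) = (Suc j choose 2) + ((N choose 2) + N * N + N)"
    by (simp only: of_nat_eq_iff mult_cancel_left) simp
  have "2 * int (((N + 1 + j) choose 2) + N * (N - j))
      = 2 * int ((Suc j choose 2) + ((N choose 2) + N * N + N))"
    unfolding of_nat_add of_nat_mult distrib_left two_times_choose_two
    by (simp add: algebra_simps)
  then show "((N + 1 + j) choose 2) + N * (N - j) = (Suc j choose 2) + ((N choose 2) + N * N + N)"
    by (simp only: of_nat_eq_iff mult_cancel_left) simp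
qed

text \<open>
  The premise on powers of \<open>q\<close>, here and below, excludes roots of unity, so that the symmetry of
  the Gaussian binomials follows from their product formula by cancellation.
\<close>
lemma qfact_neq_0:
  fixes q :: "'a::idom"
  assumes "\<And>n. n > 0 \<Longrightarrow> q ^ n \<noteq> 1"
  shows "qfact q n \<noteq> 0"
  using assms by (auto simp: qfact_def)

lemma qbinomial_symmetric:
  fixes q :: "'a::idom"
  assumes "\<And>n. n > 0 \<Longrightarrow> q ^ n \<noteq> 1" and "k \<le> n"
  shows "qbinomial q n (n - k) = qbinomial q n k"
proof -
  have "qbinomial q n (n - k) * (qfact q k * qfact q (n - k)) = qfact q n"
    using qbinomial_qfact[of "n - k" n q] assms(2) by (simp add: mult.commute)
  also have "\<dots> = qbinomial q n k * (qfact q k * qfact q (n - k))"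
    using qbinomial_qfact[of k n q] assms(2) by simp
  finally show ?thesis
    using qfact_neq_0[OF assms(1)] by auto
qed

lemma sum_fold_middle:
  fixes f :: "nat \<Rightarrow> 'a::comm_monoid_add"
  shows "(\<Sum>k\<le>2 * N + 1. f k) = (\<Sum>j\<le>N. f (N - j) + f (N + 1 + j))"
proof -
  have "(\<Sum>k\<le>2 * N + 1. f k) = (\<Sum>k\<le>N + Suc N. f k)"
    by (rule sum.cong) auto
  also have "\<dots> = (\<Sum>k\<le>N. f k) + (\<Sum>k = Suc N..N + Suc N. f k)"
    by (rule sum_up_index_split)
  also have "(\<Sum>k\<le>N. f k) = (\<Sum>j\<le>N. f (N - j))"
    using sum.nat_diff_reindex[of f "Suc N"] by (simp add: lessThan_Suc_atMost)
  also have "(\<Sum>k = Suc N..N + Suc N. f k) = (\<Sum>j\<le>N. f (N + 1 + j))"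
    by (rule sum.reindex_bij_witness[of _ "\<lambda>j. N + 1 + j" "\<lambda>k. k - (N + 1)"]) auto
  finally show ?thesis by (simp add: sum.distrib)
qed

lemma prod_power_diff_below:
  "(\<Prod>k<N. q ^ N - q ^ k) = (-1) ^ N * q ^ (N choose 2) * qfact (q::'a::comm_ring_1) N"
proof -
  have sum: "(\<Sum>k<n. k) = n choose 2" for n :: nat
    by (induction n) (simp_all add: numeral_2_eq_2)
  have "(\<Prod>k<N. q ^ N - q ^ k) = (\<Prod>k<N. (-1) * q ^ k * (1 - q ^ (N - Suc k + 1)))"
  proof (rule prod.cong)
    fix k assume "k \<in> {..<N}"
    then have "q ^ N = q ^ k * q ^ (N - Suc k + 1)"
      by (simp add: Suc_diff_Suc flip: power_add power_Suc)
    then show "q ^ N - q ^ k = (-1) * q ^ k * (1 - q ^ (N - Suc k + 1))"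
      by (simp add: algebra_simps)
  qed simp
  also have "\<dots> = (-1) ^ N * q ^ (\<Sum>k<N. k) * (\<Prod>k<N. 1 - q ^ (N - Suc k + 1))"
    unfolding prod.distrib power_sum by simp
  also have "(\<Prod>k<N. 1 - q ^ (N - Suc k + 1)) = (\<Prod>k<N. 1 - q ^ (k + 1))"
    by (rule prod.nat_diff_reindex)
  also have "\<dots> = qfact q N"
    unfolding qfact_def by (rule prod.reindex_bij_witness[of _ "\<lambda>k. k - 1" "\<lambda>k. k + 1"]) auto
  finally show ?thesis by (simp only: sum)
qed

lemma prod_power_diff_above:
  "(\<Prod>k = N + 1..2 * N. q ^ N - q ^ k) = q ^ (N * N) * qfact (q::'a::comm_ring_1) N"
proof -
  have "(\<Prod>k = N + 1..2 * N. q ^ N - q ^ k) = (\<Prod>k = 1..N. q ^ N * (1 - q ^ k))"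
    by (rule prod.reindex_bij_witness[of _ "\<lambda>k. N + k" "\<lambda>k. k - N"])
       (auto simp: right_diff_distrib simp flip: power_add)
  then show ?thesis by (simp add: prod.distrib qfact_def power_mult)
qed

lemma pderiv_sum': "pderiv (\<Sum>i\<in>A. f i) = (\<Sum>i\<in>A. pderiv (f i))"
  by (induction A rule: infinite_finite_induct) (simp_all add: pderiv_add)

text \<open>
  Differentiate the \<open>q\<close>-binomial theorem for the \<open>2N + 1\<close> factors \<open>q\<^sup>N + q\<^sup>k z\<close> at \<open>z = -1\<close>. The factor
  with \<open>k = N\<close> vanishes there, so the derivative of the product is a single product of
  differences \<open>q\<^sup>N - q\<^sup>k\<close>, a power of \<open>q\<close> times \<open>(qfact q N)\<^sup>2\<close>. On the other side the terms \<open>N - j\<close> and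
  \<open>N + 1 + j\<close> have opposite signs and equal coefficients, so the factors brought down by the
  derivative combine to \<open>(N + 1 + j) - (N - j) = 2j + 1\<close>.
\<close>
theorem finite_jacobi:
  fixes q :: "'a::idom"
  assumes q0: "q \<noteq> 0" and q1: "\<And>n. n > 0 \<Longrightarrow> q ^ n \<noteq> 1"
  shows "(\<Sum>j\<le>N. (-1) ^ j * of_nat (2 * j + 1) * q ^ (Suc j choose 2)
            * qbinomial q (2 * N + 1) (N - j)) = qfact q N ^ 2"
proof -
  define M where "M = 2 * N + 1"
  define e where "e = (N choose 2) + N * N + N"
  define P where "P = (\<Prod>k<M. [:q ^ N, q ^ k:])"
  define f where "f k = of_nat k * (q ^ (k choose 2) * qbinomial q M k * (q ^ N) ^ (M - k)) * (-1) ^ (k - 1)"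
    for k
  have "P = (\<Sum>k\<le>M. monom (q ^ (k choose 2) * qbinomial q M k * (q ^ N) ^ (M - k)) k)"
    unfolding P_def using qbinomial_theorem[of "q ^ N" 1 q M] by simp
  then have "poly (pderiv P) (-1) = (\<Sum>k\<le>M. f k)"
    by (simp add: pderiv_sum' pderiv_monom poly_sum poly_monom f_def)
  also have "\<dots> = (\<Sum>j\<le>N. f (N - j) + f (N + 1 + j))"
    unfolding M_def by (rule sum_fold_middle)
  also have "\<dots> = (\<Sum>j\<le>N. q ^ e * (-1) ^ N * ((-1) ^ j * of_nat (2 * j + 1) * q ^ (Suc j choose 2)
            * qbinomial q M (N - j)))"
  proof (rule sum.cong)
    fix j assume "j \<in> {..N}"
    then have j: "j \<le> N" by simp
    have "qbinomial q M (M - (N - j)) = qbinomial q M (N - j)"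
      using q1 by (rule qbinomial_symmetric) (simp_all add: M_def)
    moreover have M: "M - (N - j) = N + 1 + j" "M - (N + 1 + j) = N - j"
      using j by (simp_all add: M_def)
    ultimately have sym: "qbinomial q M (N + 1 + j) = qbinomial q M (N - j)" by simp
    have f1: "f (N - j) = of_nat (N - j) * (q ^ e * q ^ (Suc j choose 2) * qbinomial q M (N - j)) * (-1) ^ (N - j - 1)"
      using theta_exponent(1)[OF j, folded e_def]
      unfolding f_def M by (simp add: mult_ac add_ac flip: power_mult power_add)
    have f2: "f (N + 1 + j) = of_nat (N + 1 + j) * (q ^ e * q ^ (Suc j choose 2) * qbinomial q M (N - j)) * (-1) ^ (N + j)"
      using theta_exponent(2)[OF j, folded e_def]
      unfolding f_def M sym by (simp add: mult_ac add_ac flip: power_mult power_add)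
    (* For j = N both sides vanish, whatever the truncated exponent N - j - 1 is. *)
    have s: "of_nat (N - j) * (-1) ^ (N - j - 1) = - (of_nat (N - j) * (-1) ^ (N + j) :: 'a)"
    proof (cases "N = j")
      case False
      with j obtain d where "N = Suc (j + d)" using less_imp_Suc_add[of j N] by fastforce
      then show ?thesis by (simp add: power_add)
    qed simp
    have n: "of_nat (N + 1 + j) = of_nat (N - j) + (of_nat (2 * j + 1) :: 'a)"
      using j by (simp add: add.commute flip: of_nat_add)
    have "f (N - j) + f (N + 1 + j)
        = (q ^ e * q ^ (Suc j choose 2) * qbinomial q M (N - j))
          * (of_nat (N - j) * (-1) ^ (N - j - 1) + of_nat (N + 1 + j) * (-1) ^ (N + j))"
      unfolding f1 f2 by (simp only: algebra_simps)
    also have "\<dots> = (q ^ e * q ^ (Suc j choose 2) * qbinomial q M (N - j)) * (of_nat (2 * j + 1) * (-1) ^ (N + j))"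
      unfolding s n by (simp only: algebra_simps) simp
    finally show "f (N - j) + f (N + 1 + j) = q ^ e * (-1) ^ N * ((-1) ^ j * of_nat (2 * j + 1) * q ^ (Suc j choose 2)
            * qbinomial q M (N - j))"
      by (simp only: power_add mult_ac)
  qed simp
  finally have lhs: "poly (pderiv P) (-1) = q ^ e * (-1) ^ N * (\<Sum>j\<le>N. (-1) ^ j * of_nat (2 * j + 1)
      * q ^ (Suc j choose 2) * qbinomial q M (N - j))"
    by (simp only: sum_distrib_left)
  (* Evaluating the derivative of the product: only the summand that omits the zero factor stays. *)
  have "poly (pderiv P) (-1) = (\<Sum>l<M. (\<Prod>k\<in>{..<M} - {l}. q ^ N - q ^ k) * q ^ l)"
    unfolding P_def pderiv_prod by (simp add: poly_sum poly_prod pderiv_pCons mult.commute)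
  also have "\<dots> = (\<Sum>l\<in>{N}. (\<Prod>k\<in>{..<M} - {l}. q ^ N - q ^ k) * q ^ l)"
    by (rule sum.mono_neutral_right) (auto simp: M_def)
  also have "\<dots> = (\<Prod>k\<in>{..<M} - {N}. q ^ N - q ^ k) * q ^ N" by simp
  also have "{..<M} - {N} = {..<N} \<union> {N + 1..2 * N}" by (auto simp: M_def)
  also have "(\<Prod>k\<in>{..<N} \<union> {N + 1..2 * N}. q ^ N - q ^ k)
      = (\<Prod>k<N. q ^ N - q ^ k) * (\<Prod>k = N + 1..2 * N. q ^ N - q ^ k)"
    by (rule prod.union_disjoint) auto
  also have "\<dots> * q ^ N = q ^ e * (-1) ^ N * qfact q N ^ 2"
    unfolding prod_power_diff_below prod_power_diff_above e_def
    by (simp add: power_add power2_eq_square mult_ac)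
  finally have "q ^ e * (-1) ^ N * (\<Sum>j\<le>N. (-1) ^ j * of_nat (2 * j + 1)
      * q ^ (Suc j choose 2) * qbinomial q M (N - j)) = q ^ e * (-1) ^ N * qfact q N ^ 2"
    using lhs by simp
  then show ?thesis using q0 by (simp add: M_def)
qed

lemma dvd_diff_mult:
  fixes d :: "'a::comm_ring_1"
  assumes "d dvd a - b" "d dvd c - e"
  shows "d dvd a * c - b * e"
proof -
  have "a * c - b * e = (a - b) * c + b * (c - e)" by (simp add: algebra_simps)
  then show ?thesis using assms by simp
qed

lemma dvd_diff_trans:
  fixes d :: "'a::comm_ring_1"
  assumes "d dvd a - b" "d dvd b - c"
  shows "d dvd a - c"
  using dvd_add[OF assms] by simp

text \<open>
  Modulo \<open>q\<^sup>m\<close> the element \<open>1 - q\<^sup>k\<close> is a unit: it divides \<open>1 - (q\<^sup>k)\<^sup>m\<close>, which is congruent to 1.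
\<close>
lemma power_dvd_cancel_one_minus_power:
  fixes q :: "'a::comm_ring_1"
  assumes "q ^ m dvd (1 - q ^ k) * A" "k > 0"
  shows "q ^ m dvd A"
proof -
  have "q ^ m dvd (1 - (q ^ k) ^ m) * A"
    using assms(1) unfolding one_diff_power_eq by (metis dvd_mult2 mult.commute mult.assoc)
  moreover have "q ^ m dvd (q ^ k) ^ m * A"
    using assms(2) by (intro dvd_mult2) (simp add: le_imp_power_dvd flip: power_mult)
  ultimately have "q ^ m dvd (1 - (q ^ k) ^ m) * A + (q ^ k) ^ m * A" by (rule dvd_add)
  then show ?thesis by (simp add: algebra_simps)
qed

lemma power_dvd_cancel_qfact:
  fixes q :: "'a::comm_ring_1"
  shows "q ^ m dvd qfact q n * A \<Longrightarrow> q ^ m dvd A"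
proof (induction n arbitrary: A)
  case (Suc n)
  then have "q ^ m dvd qfact q n * ((1 - q ^ Suc n) * A)" by (simp only: qfact_Suc mult.assoc)
  then have "q ^ m dvd (1 - q ^ Suc n) * A" by (rule Suc.IH)
  then show ?case by (rule power_dvd_cancel_one_minus_power) simp
qed simp

lemma qfact_stable:
  fixes q :: "'a::comm_ring_1"
  assumes "m \<le> n"
  shows "q ^ (m + 1) dvd qfact q n - qfact q m"
  using assms
proof (induction rule: dec_induct)
  case (step n)
  have "q ^ (m + 1) dvd q ^ Suc n" using step by (intro le_imp_power_dvd) simp
  then have "q ^ (m + 1) dvd (qfact q n - qfact q m) - qfact q n * q ^ Suc n"
    using step.IH by (intro dvd_diff[of _ "_ - _"] dvd_mult)
  then show ?case by (simp add: algebra_simps)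
qed simp

lemma le_triangular: "j \<le> (Suc j choose 2)"
  by (simp add: numeral_2_eq_2)

text \<open>
  Take the finite identity with \<open>N = 2m\<close> and multiply it by \<open>qfact q m\<close>. All \<open>q\<close>-factorials of index
  at least \<open>m\<close> agree modulo \<open>q\<^bsup>m+1\<^esup>\<close> and can be cancelled, so that \<open>qfact q m\<close> times the Gaussian
  binomial of the \<open>j\<close>-th term becomes 1 for \<open>j \<le> m\<close>, while for \<open>j > m\<close> the term itself vanishes.
\<close>
theorem jacobi_qfact_cubed:
  fixes q :: "'a::idom"
  assumes q0: "q \<noteq> 0" and q1: "\<And>n. n > 0 \<Longrightarrow> q ^ n \<noteq> 1"
  shows "q ^ (m + 1) dvd qfact q m ^ 3 - (\<Sum>j\<le>m. (-1) ^ j * of_nat (2 * j + 1) * q ^ (Suc j choose 2))"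
proof -
  define d where "d = q ^ (m + 1)"
  define B where "B j = qbinomial q (2 * (2 * m) + 1) (2 * m - j)" for j
  define t where "t j = (-1) ^ j * of_nat (2 * j + 1) * q ^ (Suc j choose 2)" for j
  have B: "d dvd qfact q m * B j - 1" if "j \<le> m" for j
  proof -
    have "d dvd qfact q (2 * m - j) * qfact q (2 * m + 1 + j) - qfact q m * qfact q m"
      unfolding d_def using that by (intro dvd_diff_mult qfact_stable) auto
    then have x1: "d dvd B j * (qfact q (2 * m - j) * qfact q (2 * m + 1 + j)) - B j * (qfact q m * qfact q m)"
      by (intro dvd_diff_mult[of d "B j" "B j"]) auto
    have x2: "B j * (qfact q (2 * m - j) * qfact q (2 * m + 1 + j)) = qfact q (2 * (2 * m) + 1)"
    proof -
      have "2 * (2 * m) + 1 - (2 * m - j) = 2 * m + 1 + j" using that by simp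
      then show ?thesis
        using qbinomial_qfact[of "2 * m - j" "2 * (2 * m) + 1" q] by (simp only: B_def)
    qed
    have x3: "d dvd qfact q (2 * (2 * m) + 1) - qfact q m"
      unfolding d_def by (rule qfact_stable) simp
    have "d dvd (qfact q (2 * (2 * m) + 1) - qfact q m) - (qfact q (2 * (2 * m) + 1) - B j * (qfact q m * qfact q m))"
      using x3 x1[unfolded x2] by (rule dvd_diff)
    also have "\<dots> = qfact q m * (qfact q m * B j - 1)"
      by (simp only: algebra_simps) simp
    finally have "d dvd qfact q m * (qfact q m * B j - 1)" .
    then show ?thesis unfolding d_def by (rule power_dvd_cancel_qfact)
  qed
  have "d dvd qfact q m * qfact q m ^ 2 - qfact q m * qfact q (2 * m) ^ 2"
  proof -
    have "d dvd qfact q (2 * m) - qfact q m" unfolding d_def by (rule qfact_stable) simp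
    then have "d dvd qfact q m - qfact q (2 * m)"
      using dvd_minus_iff[of d "qfact q (2 * m) - qfact q m"] by (simp only: minus_diff_eq)
    then show ?thesis
      unfolding power2_eq_square by (intro dvd_diff_mult[of d "qfact q m" "qfact q m"] dvd_diff_mult[of d "qfact q m" "qfact q (2 * m)"]) simp_all
  qed
  then have y1: "d dvd qfact q m ^ 3 - qfact q m * qfact q (2 * m) ^ 2"
    by (simp add: power2_eq_square power3_eq_cube mult.assoc)
  have y2: "qfact q m * qfact q (2 * m) ^ 2 = (\<Sum>j\<le>2 * m. t j * (qfact q m * B j))"
  proof -
    have "qfact q (2 * m) ^ 2 = (\<Sum>j\<le>2 * m. t j * B j)"
      unfolding t_def B_def by (rule finite_jacobi[OF assms, symmetric])
    then show ?thesis by (simp only: sum_distrib_left mult_ac)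
  qed
  have y3: "d dvd (\<Sum>j\<le>2 * m. t j * (qfact q m * B j)) - (\<Sum>j\<le>m. t j)"
  proof -
    have "(\<Sum>j\<le>m. t j) = (\<Sum>j\<le>2 * m. if j \<le> m then t j else 0)"
      by (rule sum.mono_neutral_cong_left) auto
    moreover have "d dvd (\<Sum>j\<le>2 * m. t j * (qfact q m * B j) - (if j \<le> m then t j else 0))"
    proof (rule dvd_sum)
      fix j
      show "d dvd t j * (qfact q m * B j) - (if j \<le> m then t j else 0)"
      proof (cases "j \<le> m")
        case True
        then have "d dvd t j * (qfact q m * B j) - t j * 1"
          by (intro dvd_diff_mult B) auto
        with True show ?thesis by simp
      next
        case False
        then have "m + 1 \<le> (Suc j choose 2)" using le_triangular[of j] by linarith
        then have "d dvd t j" unfolding d_def t_def by (intro dvd_mult le_imp_power_dvd)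
        with False show ?thesis by simp
      qed
    qed
    ultimately show ?thesis by (simp add: sum_subtractf)
  qed
  show ?thesis using dvd_diff_trans[OF y1[unfolded y2] y3] unfolding d_def t_def .
qed

section \<open>Coefficients of the truncated products\<close>

definition triangular_reps :: "nat \<Rightarrow> nat \<Rightarrow> nat \<Rightarrow> (nat \<times> nat) set" where
  "triangular_reps a b n = {(j, k). a * (Suc j choose 2) + b * (Suc k choose 2) = n}"

definition theta_term :: "nat \<times> nat \<Rightarrow> int" where
  "theta_term = (\<lambda>(j, k). (-1) ^ (j + k) * (2 * int j + 1) * (2 * int k + 1))"

text \<open>
  Truncations of the infinite product. Their coefficients up to index \<open>N\<close> are already those of the
  limit (\<open>eta_product_nth\<close>).
\<close>
definition eta_product :: "nat \<Rightarrow> nat \<Rightarrow> nat \<Rightarrow> 'a::comm_ring_1 fps" where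
  "eta_product a b N = qfact (fps_X ^ a) N ^ 3 * qfact (fps_X ^ b) N ^ 3"

lemma fps_X_power_dvd_nth_eq_0:
  fixes f :: "'a::comm_ring_1 fps"
  assumes "fps_X ^ m dvd f" "n < m"
  shows "fps_nth f n = 0"
  using assms by (auto elim!: dvdE simp: fps_X_power_mult_nth)

text \<open>
  Congruence modulo \<open>X\<^bsup>N+1\<^esup>\<close> means equality of the coefficients up to index \<open>N\<close>. In this form the
  expansions for two exponents \<open>a\<close> and \<open>b\<close> can be multiplied.
\<close>
lemma jacobi_fps_truncated:
  fixes N :: nat
  assumes "a > 0"
  shows "(fps_X :: 'a::idom fps) ^ (N + 1) dvd qfact (fps_X ^ a) N ^ 3
           - (\<Sum>j\<le>N. (-1) ^ j * of_nat (2 * j + 1) * fps_X ^ (a * (Suc j choose 2)))"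
proof -
  have "(fps_X ^ a :: 'a fps) ^ n \<noteq> 1" if "n > 0" for n
  proof
    assume "(fps_X ^ a :: 'a fps) ^ n = 1"
    moreover have "fps_nth (fps_X ^ (a * n) :: 'a fps) 0 = 0"
      using assms that by (subst fps_X_power_nth) simp
    ultimately show False by (metis fps_one_nth power_mult zero_neq_one)
  qed
  then have "(fps_X ^ a :: 'a fps) ^ (N + 1) dvd qfact (fps_X ^ a) N ^ 3
           - (\<Sum>j\<le>N. (-1) ^ j * of_nat (2 * j + 1) * (fps_X ^ a) ^ (Suc j choose 2))"
    by (intro jacobi_qfact_cubed) simp_all
  moreover have "(fps_X :: 'a fps) ^ (N + 1) dvd (fps_X ^ a) ^ (N + 1)"
    using assms by (intro dvd_power_same) (simp add: dvd_power)
  ultimately show ?thesis unfolding power_mult by (rule dvd_trans[rotated])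
qed

theorem eta_product_nth:
  assumes "a > 0" "b > 0" "n \<le> N"
  shows "fps_nth (eta_product a b N :: 'a::idom fps) n = of_int (\<Sum>r\<in>triangular_reps a b n. theta_term r)"
proof -
  define T where "T c = (\<Sum>j\<le>N. (-1) ^ j * of_nat (2 * j + 1) * (fps_X :: 'a fps) ^ (c * (Suc j choose 2)))"
    for c
  have "fps_X ^ (N + 1) dvd eta_product a b N - T a * T b"
    unfolding eta_product_def T_def using assms by (intro dvd_diff_mult jacobi_fps_truncated)
  then have "fps_nth (eta_product a b N - T a * T b) n = 0"
    by (rule fps_X_power_dvd_nth_eq_0) (use assms in simp)
  then have "fps_nth (eta_product a b N) n = fps_nth (T a * T b) n" by simp
  also have "T a * T b = (\<Sum>(j, k)\<in>{..N} \<times> {..N}. fps_const (of_int (theta_term (j, k))) * fps_X ^ (a * (Suc j choose 2) + b * (Suc k choose 2)))"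
    unfolding T_def sum_product sum.cartesian_product
  proof (rule sum.cong, simp, clarify)
    fix j k
    have e: "(-1) ^ i * of_nat (2 * i + 1) = (fps_const (of_int ((-1) ^ i * (2 * int i + 1))) :: 'a fps)"
      for i
      by (simp only: fps_of_int) simp
    show "(-1) ^ j * of_nat (2 * j + 1) * fps_X ^ (a * (Suc j choose 2)) *
       ((-1) ^ k * of_nat (2 * k + 1) * fps_X ^ (b * (Suc k choose 2))) =
       (fps_const (of_int (theta_term (j, k))) * fps_X ^ (a * (Suc j choose 2) + b * (Suc k choose 2)) :: 'a fps)"
      unfolding e theta_term_def
      by (simp add: power_add mult_ac flip: fps_const_mult)
  qed
  also have "fps_nth \<dots> n = (\<Sum>(j, k)\<in>{..N} \<times> {..N}.
      if a * (Suc j choose 2) + b * (Suc k choose 2) = n then of_int (theta_term (j, k)) else 0)"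
    by (auto simp: fps_sum_nth fps_X_power_nth intro!: sum.cong)
  also have "\<dots> = (\<Sum>r\<in>triangular_reps a b n. of_int (theta_term r))"
  proof (rule sum.mono_neutral_cong_right)
    show "triangular_reps a b n \<subseteq> {..N} \<times> {..N}"
    proof
      fix r assume "r \<in> triangular_reps a b n"
      then obtain j k where r: "r = (j, k)" and n: "a * (Suc j choose 2) + b * (Suc k choose 2) = n"
        by (auto simp: triangular_reps_def)
      have "1 * j \<le> a * (Suc j choose 2)" "1 * k \<le> b * (Suc k choose 2)"
        using assms by (intro mult_le_mono le_triangular; simp)+
      then show "r \<in> {..N} \<times> {..N}" using n assms(3) by (simp add: r)
    qed
  qed (auto simp: triangular_reps_def split: if_splits)
  finally show ?thesis by simp
qed

section \<open>The power series of the infinite product\<close>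

definition eta_factor :: "nat \<Rightarrow> nat \<Rightarrow> nat \<Rightarrow> complex \<Rightarrow> complex" where
  "eta_factor a b k q = (1 - q ^ (a * Suc k)) ^ 3 * (1 - q ^ (b * Suc k)) ^ 3"

lemma eta_factor_has_fps_expansion:
  "(\<lambda>q. \<Prod>k<N. eta_factor a b k q) has_fps_expansion eta_product a b N"
proof -
  have q: "qfact (fps_X ^ c) N = (\<Prod>k<N. 1 - fps_X ^ (c * Suc k) :: complex fps)" for c
    unfolding qfact_def power_mult[symmetric]
    by (rule prod.reindex_bij_witness[of _ "\<lambda>k. k + 1" "\<lambda>k. k - 1"]) auto
  have "(\<lambda>q. \<Prod>k<N. eta_factor a b k q) has_fps_expansion
      (\<Prod>k<N. (1 - fps_X ^ (a * Suc k)) ^ 3 * (1 - fps_X ^ (b * Suc k)) ^ 3)"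
    unfolding eta_factor_def by (intro fps_expansion_intros)
  then show ?thesis by (simp only: eta_product_def q prod.distrib prod_power_distrib)
qed

text \<open>
  A crude geometric bound, which suffices for uniform convergence: with \<open>u\<close> and \<open>v\<close> the powers of
  \<open>q\<close> in the two factors, \<open>|(1-u)\<^sup>3 - 1| \<le> 7|u|\<close> and \<open>|(1-u)\<^sup>3| \<le> 8\<close>, whence \<open>7 \<cdot> 8 + 7 = 63\<close>.
\<close>
lemma norm_eta_factor_minus_1:
  assumes "a > 0" "b > 0" "norm q \<le> r" "r < 1"
  shows "norm (eta_factor a b k q - 1) \<le> 63 * r ^ Suc k"
proof -
  have r0: "0 \<le> r" using assms(3) norm_ge_zero order_trans by blast
  have small: "norm (q ^ (c * Suc k)) \<le> r ^ Suc k" if "c > 0" for c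
  proof -
    have "norm (q ^ (c * Suc k)) \<le> r ^ (c * Suc k)"
      unfolding norm_power using assms by (intro power_mono) auto
    also have "\<dots> \<le> r ^ Suc k"
      using mult_le_mono1[of 1 c "Suc k"] that assms r0 by (intro power_decreasing) simp_all
    finally show ?thesis .
  qed
  have cube: "norm ((1 - u) ^ 3 - 1) \<le> 7 * norm u" "norm ((1 - u) ^ 3) \<le> 8" if "norm u \<le> 1"
    for u :: complex
  proof -
    have "norm (3 - 3 * u + u\<^sup>2) \<le> norm (3 - 3 * u) + norm (u\<^sup>2)"
      by (rule norm_triangle_ineq)
    also have "norm (3 - 3 * u) \<le> norm (3 :: complex) + norm (3 * u)"
      by (rule norm_triangle_ineq4)
    also have "norm (3 :: complex) + norm (3 * u) + norm (u\<^sup>2) \<le> 7"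
      using that power_mono[OF that, of 2] by (simp add: norm_mult norm_power)
    finally have "norm (3 - 3 * u + u\<^sup>2) \<le> 7" by simp
    moreover have "(1 - u) ^ 3 - 1 = - u * (3 - 3 * u + u\<^sup>2)" by algebra
    ultimately show "norm ((1 - u) ^ 3 - 1) \<le> 7 * norm u"
      using mult_left_mono[of "norm (3 - 3 * u + u\<^sup>2)" 7 "norm u"] by (simp add: norm_mult mult.commute)
    have "norm (1 - u) \<le> 2" using norm_triangle_ineq4[of 1 u] that by simp
    then have "norm (1 - u) ^ 3 \<le> 2 ^ 3" by (intro power_mono) auto
    then show "norm ((1 - u) ^ 3) \<le> 8" by (simp add: norm_power)
  qed
  define u v where "u = q ^ (a * Suc k)" and "v = q ^ (b * Suc k)"
  have u: "norm u \<le> r ^ Suc k" "norm u \<le> 1" and v: "norm v \<le> r ^ Suc k" "norm v \<le> 1"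
    using small assms r0 power_le_one[of r "Suc k"] unfolding u_def v_def by (auto intro: order_trans)
  have "eta_factor a b k q - 1 = ((1 - u) ^ 3 - 1) * (1 - v) ^ 3 + ((1 - v) ^ 3 - 1)"
    unfolding eta_factor_def u_def v_def by algebra
  also have "norm \<dots> \<le> norm ((1 - u) ^ 3 - 1) * norm ((1 - v) ^ 3) + norm ((1 - v) ^ 3 - 1)"
    using norm_triangle_ineq by (simp add: norm_mult[symmetric])
  also have "\<dots> \<le> (7 * r ^ Suc k) * 8 + 7 * r ^ Suc k"
    using cube(1)[OF u(2)] cube[OF v(2)] u(1) v(1) r0
    by (intro add_mono mult_mono) auto
  finally show ?thesis by simp
qed

lemma uniform_limit_eta_factor:
  assumes "a > 0" "b > 0" "r < 1"
  shows "uniform_limit (cball 0 r) (\<lambda>N q. \<Prod>k<N. eta_factor a b k q) (\<lambda>q. \<Prod>k. eta_factor a b k q) sequentially"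
proof (cases "r \<ge> 0")
  case True
  have bound: "norm (norm (eta_factor a b k q - 1)) \<le> 63 * r ^ Suc k" if "q \<in> cball 0 r"
    for k q
    using norm_eta_factor_minus_1[OF assms(1,2) _ assms(3)] that by simp
  have summ: "summable (\<lambda>k. 63 * r ^ Suc k)"
    using True assms by (intro summable_mult) (simp add: summable_geometric)
  have "uniformly_convergent_on (cball 0 r) (\<lambda>N q. \<Prod>k<N. eta_factor a b k q)"
  proof (rule uniformly_convergent_on_prod')
    show "uniformly_convergent_on (cball 0 r) (\<lambda>N q. \<Sum>k<N. norm (eta_factor a b k q - 1))"
      using bound summ by (rule Weierstrass_m_test')
  qed (auto simp: eta_factor_def intro!: continuous_intros)
  then obtain G where G: "uniform_limit (cball 0 r) (\<lambda>N q. \<Prod>k<N. eta_factor a b k q) G sequentially"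
    by (auto simp: uniformly_convergent_on_def)
  have "G q = (\<Prod>k. eta_factor a b k q)" if q: "q \<in> cball 0 r" for q
  proof -
    have "summable (\<lambda>k. norm (eta_factor a b k q - 1))"
      using bound[OF q] summ by (rule summable_comparison_test'[where N = 0, rotated])
    then have "convergent_prod (\<lambda>k. eta_factor a b k q)"
      by (intro abs_convergent_prod_imp_convergent_prod summable_imp_abs_convergent_prod)
    then have "(\<lambda>N. \<Prod>k<N. eta_factor a b k q) \<longlonglongrightarrow> (\<Prod>k. eta_factor a b k q)"
      using convergent_prod_LIMSEQ LIMSEQ_lessThan_iff_atMost by blast
    moreover have "(\<lambda>N. \<Prod>k<N. eta_factor a b k q) \<longlonglongrightarrow> G q"
      using tendsto_uniform_limitI[OF G q] .
    ultimately show ?thesis using LIMSEQ_unique by blast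
  qed
  then show ?thesis using G by (subst uniform_limit_cong'[where g = "\<lambda>N q. \<Prod>k<N. eta_factor a b k q" and i = G]) simp_all
qed (simp add: uniform_limit_iff)

text \<open>
  By Weierstrass the uniform limit is holomorphic, and its Taylor coefficients are the limits of
  those of the finite products, which are eventually constant.
\<close>
theorem eta_product_sums:
  assumes "a > 0" "b > 0" "norm q < 1"
  shows "(\<lambda>n. of_int (\<Sum>r\<in>triangular_reps a b n. theta_term r) * q ^ n) sums (\<Prod>k. eta_factor a b k q)"
proof -
  define F where "F q = (\<Prod>k. eta_factor a b k q)" for q
  define h :: "complex fps" where "h = Abs_fps (\<lambda>n. of_int (\<Sum>r\<in>triangular_reps a b n. theta_term r))"
  have unif: "uniform_limit (cball 0 r) (\<lambda>N q. \<Prod>k<N. eta_factor a b k q) F sequentially" if "r < 1"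
    for r
    unfolding F_def using assms(1,2) that by (rule uniform_limit_eta_factor)
  have hol: "(\<lambda>q. \<Prod>k<N. eta_factor a b k q) holomorphic_on A" for N A
    unfolding eta_factor_def by (intro holomorphic_intros)
  have holF: "F holomorphic_on ball 0 r" if "r < 1" for r
    by (rule holomorphic_uniform_limit[OF _ unif[OF that]])
       (auto intro!: hol holomorphic_on_imp_continuous_on always_eventually)
  (* Uniform convergence holds only on smaller discs; being holomorphic is a local property. *)
  have F1: "F holomorphic_on ball 0 1"
    unfolding holomorphic_on_open[OF open_ball]
  proof
    fix z :: complex assume "z \<in> ball 0 1"
    then obtain r where r: "norm z < r" "r < 1" using dense[of "norm z" 1] by auto
    then show "\<exists>f'. (F has_field_derivative f') (at z)"
      using holF[OF r(2)] unfolding holomorphic_on_open[OF open_ball] by auto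
  qed
  have "F analytic_on {0}" using F1 by (auto simp: analytic_at intro!: exI[of _ "ball 0 1"])
  then obtain g where g: "F has_fps_expansion g"
    using analytic_at_imp_has_fps_expansion_0 by blast
  have "g = h"
  proof (rule uniform_limit_imp_fps_expansion_eq)
    show "(\<lambda>N. eta_product a b N) \<longlonglongrightarrow> h"
      unfolding tendsto_fps_iff
    proof
      fix n
      show "\<forall>\<^sub>F N in sequentially. fps_nth (eta_product a b N) n = fps_nth h n"
        using eventually_ge_at_top[of n] by eventually_elim (simp add: h_def eta_product_nth assms)
    qed
    show "uniform_limit (ball 0 (1/2)) (\<lambda>N q. \<Prod>k<N. eta_factor a b k q) F sequentially"
      by (rule uniform_limit_on_subset[OF unif[of "1/2"]]) auto
    show "F has_fps_expansion g" by (rule g)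
  qed (auto intro!: always_eventually hol eta_factor_has_fps_expansion)
  with g have "F has_fps_expansion h" by simp
  then have "(\<lambda>n. fps_nth h n * q ^ n) sums F q"
    using F1 assms(3) by (intro has_fps_expansion_imp_sums_complex[where r = 1]) (auto simp: one_ereal_def)
  then show ?thesis by (simp add: h_def F_def)
qed

lemma power_series_coeffs_unique:
  fixes c d :: "nat \<Rightarrow> complex"
  assumes "\<And>q. norm q < 1 \<Longrightarrow> (\<lambda>n. c n * q ^ n) sums f q" "\<And>q. norm q < 1 \<Longrightarrow> (\<lambda>n. d n * q ^ n) sums f q"
  shows "c = d"
proof -
  have near0: "\<forall>\<^sub>F q in nhds (0::complex). norm q < 1"
    using eventually_nhds_in_open[of "ball 0 1" "0::complex"] by simp
  have "f has_fps_expansion Abs_fps c" "f has_fps_expansion Abs_fps d"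
    by (rule has_fps_expansionI; use near0 in eventually_elim; simp add: assms)+
  then have "Abs_fps c = Abs_fps d" by (rule fps_expansion_unique_complex)
  then show ?thesis by (metis fps_nth_Abs_fps ext)
qed

text \<open>
  The shift of the index by one comes from the factor \<open>q\<close> in front of the product.
\<close>
theorem lambda_coeff_Suc:
  assumes "a > 0" "b > 0"
  shows "lambda_coeff a b (Suc n) = (\<Sum>r\<in>triangular_reps a b n. theta_term r)"
proof -
  define c :: "nat \<Rightarrow> int" where
    "c n = (case n of 0 \<Rightarrow> 0 | Suc m \<Rightarrow> \<Sum>r\<in>triangular_reps a b m. theta_term r)"
      for n
  have c: "(\<lambda>n. of_int (c n) * q ^ n) sums
      (q * (\<Prod>k. (1 - q ^ (a * Suc k)) ^ 3 * (1 - q ^ (b * Suc k)) ^ 3))" if "norm q < 1" for q :: complex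
  proof -
    have "(\<lambda>n. q * (of_int (\<Sum>r\<in>triangular_reps a b n. theta_term r) * q ^ n)) sums (q * (\<Prod>k. eta_factor a b k q))"
      by (intro sums_mult eta_product_sums assms that)
    then have "(\<lambda>n. of_int (c (Suc n)) * q ^ Suc n) sums (q * (\<Prod>k. eta_factor a b k q))"
      by (simp add: c_def mult_ac del: of_int_sum)
    then show ?thesis
      unfolding eta_factor_def by (subst (asm) sums_Suc_iff) (simp add: c_def)
  qed
  have "lambda_coeff a b = c"
    unfolding lambda_coeff_def
  proof (rule the_equality)
    fix d :: "nat \<Rightarrow> int"
    assume d: "d 0 = 0 \<and> (\<forall>q::complex. norm q < 1 \<longrightarrow> (\<lambda>n. of_int (d n) * q ^ n) sums
          (q * (\<Prod>k. (1 - q ^ (a * Suc k)) ^ 3 * (1 - q ^ (b * Suc k)) ^ 3)))"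
    have "(\<lambda>n. of_int (d n) :: complex) = (\<lambda>n. of_int (c n))"
      by (rule power_series_coeffs_unique) (use c d in blast)+
    then show "d = c" by (auto simp: fun_eq_iff)
  qed (use c in \<open>simp add: c_def\<close>)
  then show ?thesis by (simp add: c_def)
qed

section \<open>The recurrence given by the logarithmic derivative\<close>

text \<open>
  The relation \<open>q f' = f L\<close> in the place of \<open>L = q f'/f\<close> makes sense over every commutative ring.
\<close>
definition has_log_derivative :: "'a::comm_ring_1 fps \<Rightarrow> 'a fps \<Rightarrow> bool" where
  "has_log_derivative f L \<longleftrightarrow> fps_X * fps_deriv f = f * L"

lemma has_log_derivative_mult:
  "has_log_derivative f L \<Longrightarrow> has_log_derivative g M \<Longrightarrow> has_log_derivative (f * g) (L + M)"
proof -
  assume "has_log_derivative f L" "has_log_derivative g M"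
  then have f: "fps_X * fps_deriv f = f * L" and g: "fps_X * fps_deriv g = g * M"
    by (simp_all only: has_log_derivative_def)
  have "fps_X * fps_deriv (f * g) = f * (fps_X * fps_deriv g) + (fps_X * fps_deriv f) * g"
    by (simp add: algebra_simps)
  also have "\<dots> = f * g * (L + M)" unfolding f g by (simp only: algebra_simps)
  finally show ?thesis by (simp only: has_log_derivative_def)
qed

lemma has_log_derivative_1: "has_log_derivative 1 0"
  by (simp add: has_log_derivative_def)

lemma has_log_derivative_power:
  "has_log_derivative f L \<Longrightarrow> has_log_derivative (f ^ n) (of_nat n * L)"
  by (induction n) (auto simp: has_log_derivative_1 distrib_right intro!: has_log_derivative_mult)

lemma fps_nth_X_mult_deriv: "fps_nth (fps_X * fps_deriv f) n = of_nat n * fps_nth f n"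
  by (cases n) simp_all

text \<open>The geometric series \<open>c X\<^sup>c / (1 - X\<^sup>c)\<close>.\<close>
definition divisor_fps :: "nat \<Rightarrow> 'a::comm_ring_1 fps" where
  "divisor_fps c = Abs_fps (\<lambda>m. if m > 0 \<and> c dvd m then of_nat c else 0)"

lemma has_log_derivative_one_minus_power:
  assumes "c > 0"
  shows "has_log_derivative (1 - fps_X ^ c) (- divisor_fps c)"
proof -
  have "(1 - fps_X ^ c) * divisor_fps c = of_nat c * (fps_X ^ c :: 'a fps)"
  proof (rule fps_ext)
    fix m
    have "(m > 0 \<and> c dvd m) \<longleftrightarrow> m = c \<or> (c \<le> m \<and> m - c > 0 \<and> c dvd m - c)"
      using assms by (cases "c \<le> m") (auto simp: dvd_diff_nat dest: dvd_imp_le dvd_diffD)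
    then show "fps_nth ((1 - fps_X ^ c) * divisor_fps c) m = fps_nth (of_nat c * (fps_X ^ c :: 'a fps)) m"
      using assms by (auto simp: algebra_simps fps_X_power_mult_nth divisor_fps_def fps_X_power_nth fps_mult_of_nat_nth not_less)
  qed
  moreover have "fps_X * fps_deriv (1 - fps_X ^ c) = - (of_nat c * (fps_X ^ c :: 'a fps))"
    using assms by (intro fps_ext) (simp add: fps_nth_X_mult_deriv fps_X_power_nth fps_mult_of_nat_nth del: fps_deriv_sub)
  ultimately show ?thesis by (simp add: has_log_derivative_def)
qed

lemma has_log_derivative_qfact:
  assumes "a > 0"
  shows "has_log_derivative (qfact (fps_X ^ a) N) (- (\<Sum>k=1..N. divisor_fps (a * k)))"
proof (induction N)
  case 0
  show ?case by (simp add: has_log_derivative_1)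
next
  case (Suc N)
  have "has_log_derivative (1 - fps_X ^ (a * Suc N)) (- divisor_fps (a * Suc N) :: 'a fps)"
    using assms by (intro has_log_derivative_one_minus_power) simp
  from has_log_derivative_mult[OF Suc.IH this] show ?case
    by (simp add: power_mult[symmetric] del: mult_Suc_right power_Suc)
qed

text \<open>
  This is \<open>a \<sigma>(m/a)\<close> (see \<open>sigma_multiple_eq\<close>), written as the sum that arises from adding up the
  series \<open>divisor_fps (a * k)\<close>: the divisors of \<open>m\<close> that are multiples of \<open>a\<close>.
\<close>
definition sigma_multiple :: "nat \<Rightarrow> nat \<Rightarrow> nat" where
  "sigma_multiple a m = (\<Sum>k | k \<in> {1..m} \<and> a * k dvd m. a * k)"

theorem eta_product_recurrence:
  assumes "a > 0" "b > 0" "n \<le> N"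
  shows "of_nat n * fps_nth (eta_product a b N :: 'a::comm_ring_1 fps) n
    = (\<Sum>m=1..n. -3 * of_nat (sigma_multiple a m + sigma_multiple b m) * fps_nth (eta_product a b N) (n - m))"
proof -
  define L where "L a = (\<Sum>k=1..N. divisor_fps (a * k) :: 'a fps)" for a
  define P where "P = (eta_product a b N :: 'a fps)"
  have L: "fps_nth (L a) m = of_nat (sigma_multiple a m)" if "m > 0" "m \<le> N" "a > 0" for a m
  proof -
    have "fps_nth (L a) m = (\<Sum>k=1..N. if a * k dvd m then of_nat (a * k) else 0)"
      using that by (simp add: L_def divisor_fps_def fps_sum_nth)
    also have "\<dots> = (\<Sum>k | k \<in> {1..N} \<and> a * k dvd m. of_nat (a * k))"
      by (rule sum.inter_filter[symmetric]) simp
    also have "{k. k \<in> {1..N} \<and> a * k dvd m} = {k. k \<in> {1..m} \<and> a * k dvd m}"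
    proof -
      have "k \<le> m \<and> k \<le> N" if "a * k dvd m" for k
        using \<open>m \<le> N\<close> dvd_imp_le[OF that \<open>m > 0\<close>] \<open>a > 0\<close> le_trans[of k "a * k" m] by simp
      then show ?thesis using that by auto
    qed
    finally show ?thesis by (simp add: sigma_multiple_def)
  qed
  have L0: "fps_nth (L a) 0 = 0" for a by (simp add: L_def divisor_fps_def fps_sum_nth)
  have "has_log_derivative P (of_nat 3 * (- L a) + of_nat 3 * (- L b))"
    unfolding P_def eta_product_def L_def using assms
    by (intro has_log_derivative_mult has_log_derivative_power has_log_derivative_qfact)
  then have "fps_X * fps_deriv P = (fps_const (-3) * (L a + L b)) * P"
    unfolding has_log_derivative_def by (simp add: algebra_simps flip: fps_const_neg numeral_fps_const)
  then have "fps_nth (fps_X * fps_deriv P) n = fps_nth ((fps_const (-3) * (L a + L b)) * P) n"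
    by simp
  also have "\<dots> = (\<Sum>m=0..n. (-3 * (fps_nth (L a) m + fps_nth (L b) m)) * fps_nth P (n - m))"
    by (simp add: fps_mult_nth[of "_ * _" P])
  also have "\<dots> = (\<Sum>m=1..n. (-3 * (fps_nth (L a) m + fps_nth (L b) m)) * fps_nth P (n - m))"
    by (simp add: sum.atLeast_Suc_atMost L0)
  also have "\<dots> = (\<Sum>m=1..n. -3 * of_nat (sigma_multiple a m + sigma_multiple b m) * fps_nth P (n - m))"
    by (rule sum.cong) (use assms in \<open>simp_all add: L\<close>)
  also have "fps_nth (fps_X * fps_deriv P) n = of_nat n * fps_nth P n"
    by (rule fps_nth_X_mult_deriv)
  finally show ?thesis by (simp only: P_def)
qed

lemma eta_product_nth_0:
  assumes "a > 0" "b > 0"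
  shows "fps_nth (eta_product a b N :: 'a::comm_ring_1 fps) 0 = 1"
proof -
  have "fps_nth (qfact (fps_X ^ c) N :: 'a fps) 0 = 1" if "c > 0" for c
    using that by (induction N) (simp_all flip: power_mult power_Suc)
  with assms show ?thesis by (simp add: eta_product_def fps_power_zeroth)
qed

lemma sigma_multiple_eq:
  assumes "a > 0" "m > 0"
  shows "sigma_multiple a m = a * sigma_rat (of_nat m / of_nat a)"
proof (cases "a dvd m")
  case True
  then obtain d where d: "m = a * d" by (rule dvdE)
  have "{k. k \<in> {1..m} \<and> a * k dvd m} = {k. k dvd d}"
  proof -
    have "k \<ge> 1 \<and> k \<le> m" if "k dvd d" for k
    proof -
      have "d > 0" using assms d by simp
      then have "k > 0" "k \<le> d" using that by (auto intro: dvd_pos_nat dvd_imp_le)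
      moreover have "d \<le> m" using assms d by simp
      ultimately show ?thesis by linarith
    qed
    then show ?thesis using assms d by auto
  qed
  then show ?thesis
    using assms by (simp add: sigma_multiple_def sigma_rat_def d sum_distrib_left)
next
  case False
  have "rat_of_nat m / of_nat a \<notin> \<int>"
  proof
    assume "rat_of_nat m / of_nat a \<in> \<int>"
    then obtain z where "rat_of_nat m / of_nat a = of_int z" by (auto elim: Ints_cases)
    then have "rat_of_int (int m) = of_int (int a * z)" using assms by (simp add: field_simps)
    then have "int m = int a * z" by (simp only: of_int_eq_iff)
    then have "int a dvd int m" by simp
    then show False using False by simp
  qed
  moreover have e: "{k. k \<in> {1..m} \<and> a * k dvd m} = {}"
    using False by (auto dest: dvd_mult_left)
  ultimately show ?thesis unfolding sigma_multiple_def sigma_rat_def e by simp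
qed

section \<open>Sums over tuples of given weight\<close>

text \<open>
  The length \<open>N\<close> and the weight \<open>n\<close> are separate parameters, since the recurrence in \<open>n\<close> compares
  tuples of different weights but of the same length.
\<close>
definition tuples_of_weight :: "nat \<Rightarrow> nat \<Rightarrow> (nat \<Rightarrow> nat) set" where
  "tuples_of_weight N n = {k \<in> {1..N} \<rightarrow>\<^sub>E UNIV. (\<Sum>i=1..N. i * k i) = n}"

definition exp_term :: "(nat \<Rightarrow> 'a::field_char_0) \<Rightarrow> nat \<Rightarrow> (nat \<Rightarrow> nat) \<Rightarrow> 'a" where
  "exp_term f N k = (\<Prod>i=1..N. f i ^ k i / (of_nat i ^ k i * fact (k i)))"

lemma finite_tuples_of_weight: "finite (tuples_of_weight N n)"
proof (rule finite_subset)
  show "tuples_of_weight N n \<subseteq> {1..N} \<rightarrow>\<^sub>E {..n}"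
  proof
    fix k assume k: "k \<in> tuples_of_weight N n"
    have "k i \<le> n" if "i \<in> {1..N}" for i
    proof -
      have "k i \<le> i * k i" using that by simp
      also have "\<dots> \<le> (\<Sum>i=1..N. i * k i)" using that by (intro member_le_sum) auto
      finally show ?thesis using k by (simp add: tuples_of_weight_def)
    qed
    then show "k \<in> {1..N} \<rightarrow>\<^sub>E {..n}"
      using k by (auto simp: tuples_of_weight_def PiE_iff)
  qed
qed (auto intro: finite_PiE)

text \<open>
  \<open>exp_term f N k\<close> is the term belonging to \<open>k\<close> when the exponentials of the monomials \<open>f(i) X\<^sup>i / i\<close>,
  \<open>1 \<le> i \<le> N\<close>, are multiplied out. Raising the \<open>m\<close>-th entry by one therefore multiplies it by
  \<open>f(m) / m\<close> and divides it by the new entry.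
\<close>
lemma exp_term_increment:
  assumes m: "m \<in> {1..N}"
  shows "of_nat (m * Suc (k m)) * exp_term f N (k(m := Suc (k m))) = f m * exp_term f N k"
proof -
  let ?g = "\<lambda>k i. f i ^ k i / (of_nat i ^ k i * fact (k i))"
  have split: "exp_term f N k' = ?g k' m * (\<Prod>i\<in>{1..N} - {m}. ?g k' i)" for k'
    unfolding exp_term_def using m by (intro prod.remove) auto
  have rest: "(\<Prod>i\<in>{1..N} - {m}. ?g (k(m := Suc (k m))) i) = (\<Prod>i\<in>{1..N} - {m}. ?g k i)"
    by (rule prod.cong) auto
  have main: "of_nat (m * Suc (k m)) * ?g (k(m := Suc (k m))) m = f m * ?g k m"
  proof -
    have "M * s * (F * x / (M * y * (s * z))) = F * (x / (y * z))" if "M \<noteq> 0" "s \<noteq> 0"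
      for M s F x y z :: 'a
      using that by (simp add: field_simps)
    moreover have "of_nat m \<noteq> (0 :: 'a)" "of_nat (Suc (k m)) \<noteq> (0 :: 'a)"
      using m by (simp_all del: of_nat_Suc)
    ultimately show ?thesis by (simp only: fun_upd_same fact_Suc power_Suc of_nat_mult)
  qed
  show ?thesis unfolding split rest mult.assoc[symmetric] main ..
qed

lemma tuples_of_weight_increment:
  assumes m: "m \<in> {1..N}" and k: "k \<in> {1..N} \<rightarrow>\<^sub>E UNIV"
  shows "k(m := Suc (k m)) \<in> tuples_of_weight N n \<longleftrightarrow> m \<le> n \<and> k \<in> tuples_of_weight N (n - m)"
proof -
  have "(\<Sum>i=1..N. i * k' i) = m * k' m + (\<Sum>i\<in>{1..N} - {m}. i * k' i)" for k'
    using m by (intro sum.remove) auto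
  moreover have "(\<Sum>i\<in>{1..N} - {m}. i * (k(m := Suc (k m))) i) = (\<Sum>i\<in>{1..N} - {m}. i * k i)"
    by (rule sum.cong) auto
  ultimately have "(\<Sum>i=1..N. i * (k(m := Suc (k m))) i) = m + (\<Sum>i=1..N. i * k i)" by simp
  then show ?thesis using k m unfolding tuples_of_weight_def by (auto simp: PiE_iff extensional_def)
qed

text \<open>
  Tuples of weight \<open>n\<close> with positive \<open>m\<close>-th entry correspond to all tuples of weight \<open>n - m\<close>, by
  lowering that entry; the tuples whose \<open>m\<close>-th entry is zero contribute nothing on the left.
\<close>
lemma sum_exp_term_marked:
  assumes m: "m \<in> {1..N}"
  shows "(\<Sum>k\<in>tuples_of_weight N n. of_nat (m * k m) * exp_term f N k)
       = (if m \<le> n then f m * (\<Sum>k\<in>tuples_of_weight N (n - m). exp_term f N k) else 0)"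
proof -
  define W where "W = {k \<in> {1..N} \<rightarrow>\<^sub>E UNIV. m \<le> n \<and> k \<in> tuples_of_weight N (n - m)}"
  have "(\<Sum>k\<in>tuples_of_weight N n. of_nat (m * k m) * exp_term f N k)
      = (\<Sum>k | k \<in> tuples_of_weight N n \<and> k m \<noteq> 0. of_nat (m * k m) * exp_term f N k)"
    by (rule sum.mono_neutral_right) (auto simp: finite_tuples_of_weight)
  also have "\<dots> = (\<Sum>k\<in>W. f m * exp_term f N k)"
  proof (rule sum.reindex_bij_witness[of _ "\<lambda>k. k(m := Suc (k m))" "\<lambda>k. k(m := k m - 1)"])
    fix k assume k: "k \<in> {k. k \<in> tuples_of_weight N n \<and> k m \<noteq> 0}"
    define l where "l = k(m := k m - 1)"
    have kl: "k = l(m := Suc (l m))" using k by (auto simp: l_def fun_eq_iff)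
    have l: "l \<in> {1..N} \<rightarrow>\<^sub>E UNIV"
      using k m by (auto simp: l_def tuples_of_weight_def PiE_iff extensional_def)
    have "l \<in> W"
      using tuples_of_weight_increment[OF m l, of n] k l unfolding W_def kl[symmetric] by auto
    then show "k(m := k m - 1) \<in> W" by (simp add: l_def)
    show "(k(m := k m - 1))(m := Suc ((k(m := k m - 1)) m)) = k"
      using kl by (simp add: l_def)
    show "f m * exp_term f N (k(m := k m - 1)) = of_nat (m * k m) * exp_term f N k"
    proof -
      have "Suc (l m) = k m" using k by (simp add: l_def)
      then show ?thesis
        using exp_term_increment[OF m, of l f, folded kl] by (simp only: l_def[symmetric])
    qed
  next
    fix k assume "k \<in> W"
    then show "k(m := Suc (k m)) \<in> {k. k \<in> tuples_of_weight N n \<and> k m \<noteq> 0}"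
      using tuples_of_weight_increment[OF m, of k n] by (simp add: W_def)
    show "(k(m := Suc (k m)))(m := (k(m := Suc (k m))) m - 1) = k" by simp
  qed
  also have "W = (if m \<le> n then tuples_of_weight N (n - m) else {})"
    by (auto simp: W_def tuples_of_weight_def)
  finally show ?thesis by (simp add: sum_distrib_left)
qed

text \<open>
  On a tuple of weight \<open>n\<close> the factor \<open>n\<close> is the sum of all \<open>m \<cdot> k(m)\<close>; exchanging the two sums leaves,
  for each \<open>m\<close>, the sum of the preceding lemma.
\<close>
theorem sum_exp_term_recurrence:
  assumes "n \<le> N"
  shows "of_nat n * (\<Sum>k\<in>tuples_of_weight N n. exp_term f N k)
       = (\<Sum>m=1..n. f m * (\<Sum>k\<in>tuples_of_weight N (n - m). exp_term f N k))"
proof -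
  have "of_nat n * (\<Sum>k\<in>tuples_of_weight N n. exp_term f N k)
      = (\<Sum>k\<in>tuples_of_weight N n. \<Sum>m=1..N. of_nat (m * k m) * exp_term f N k)"
    unfolding sum_distrib_left
  proof (rule sum.cong)
    fix k assume "k \<in> tuples_of_weight N n"
    then have "n = (\<Sum>m=1..N. m * k m)" by (simp add: tuples_of_weight_def)
    then have "of_nat n = (\<Sum>m=1..N. of_nat (m * k m) :: 'a)" by simp
    then show "of_nat n * exp_term f N k = (\<Sum>m=1..N. of_nat (m * k m) * exp_term f N k)"
      by (simp add: sum_distrib_right)
  qed simp
  also have "\<dots> = (\<Sum>m=1..N. \<Sum>k\<in>tuples_of_weight N n. of_nat (m * k m) * exp_term f N k)"
    by (rule sum.swap)
  also have "\<dots> = (\<Sum>m=1..N. if m \<le> n then f m * (\<Sum>k\<in>tuples_of_weight N (n - m). exp_term f N k) else 0)"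
    by (rule sum.cong) (simp_all only: sum_exp_term_marked)
  also have "\<dots> = (\<Sum>m=1..n. f m * (\<Sum>k\<in>tuples_of_weight N (n - m). exp_term f N k))"
    using assms by (intro sum.mono_neutral_cong_right) auto
  finally show ?thesis .
qed

lemma sum_exp_term_0: "(\<Sum>k\<in>tuples_of_weight N 0. exp_term f N k) = 1"
proof -
  have "tuples_of_weight N 0 = {\<lambda>i\<in>{1..N}. 0}"
    by (auto simp: tuples_of_weight_def PiE_iff extensional_def fun_eq_iff restrict_def)
  then show ?thesis by (simp add: exp_term_def)
qed

theorem eta_product_nth_eq_sum_exp_term:
  assumes "a > 0" "b > 0" "n \<le> N"
  shows "fps_nth (eta_product a b N :: 'a::field_char_0 fps) n
    = (\<Sum>k\<in>tuples_of_weight N n. exp_term (\<lambda>m. -3 * of_nat (sigma_multiple a m + sigma_multiple b m)) N k)"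
  using assms(3)
proof (induction n rule: less_induct)
  case (less n)
  show ?case
  proof (cases "n = 0")
    case True
    then show ?thesis using assms by (simp add: eta_product_nth_0 sum_exp_term_0)
  next
    case False
    have "of_nat n * fps_nth (eta_product a b N :: 'a fps) n =
      of_nat n * (\<Sum>k\<in>tuples_of_weight N n. exp_term (\<lambda>m. -3 * of_nat (sigma_multiple a m + sigma_multiple b m)) N k)"
      unfolding eta_product_recurrence[OF assms(1,2) less.prems] sum_exp_term_recurrence[OF less.prems]
      using less by (intro sum.cong) simp_all
    then show ?thesis using False by simp
  qed
qed

section \<open>Representations of \<open>(ab+1)p\<close> by the form \<open>aX\<^sup>2 + bY\<^sup>2\<close>\<close>

lemma prime_eq_mult_square:
  fixes b p y :: int
  assumes "prime p" and p: "p = b * y\<^sup>2" and "b > 0"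
  shows "b = p"
proof -
  have "\<not> p dvd y"
  proof
    assume "p dvd y"
    then have "p\<^sup>2 dvd b * y\<^sup>2" by (simp add: dvd_mult)
    then have "p * p dvd p * 1" using p by (simp add: power2_eq_square)
    then have "p dvd 1" using \<open>prime p\<close> by (simp del: mult_1_right)
    then show False using \<open>prime p\<close> not_prime_unit by blast
  qed
  then have "\<not> p dvd y\<^sup>2" using \<open>prime p\<close> prime_dvd_power by blast
  moreover have "p dvd b * y\<^sup>2" using p by simp
  ultimately have "p dvd b" using \<open>prime p\<close> prime_dvd_multD by blast
  moreover have "b dvd p" using p by simp
  ultimately show ?thesis
    using \<open>b > 0\<close> prime_gt_0_int[OF \<open>prime p\<close>] by (simp add: zdvd_antisym_nonneg)
qed

text \<open>
  If \<open>x\<close> were 0, then \<open>p = b y\<^sup>2\<close> and so \<open>p = b\<close>. Otherwise \<open>a \<le> a x\<^sup>2 \<le> p\<close>, and \<open>a\<close> is smaller than \<open>p\<close>.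
\<close>
lemma prime_form_not_dvd:
  fixes a b p x y :: int
  assumes "prime p" "p = a * x\<^sup>2 + b * y\<^sup>2" "a > 0" "b > 0" "p \<noteq> a" "p \<noteq> b"
  shows "x \<noteq> 0" and "\<not> p dvd a"
proof -
  show x: "x \<noteq> 0" using prime_eq_mult_square[of p b y] assms by auto
  then have "x\<^sup>2 \<ge> 1" by (simp add: int_one_le_iff_zero_less)
  then have "a * 1 \<le> a * x\<^sup>2" using assms by (intro mult_left_mono) auto
  moreover have "0 \<le> b * y\<^sup>2" using assms by simp
  ultimately have "a \<le> p" using assms(2) by linarith
  then have "a < p" using assms by simp
  then show "\<not> p dvd a" using assms(3) zdvd_not_zless by blast
qed

text \<open>
  Brahmagupta's identity reads \<open>(aXx + bYy)\<^sup>2 + ab(Xy - Yx)\<^sup>2 = (ab+1)p\<^sup>2\<close>. If \<open>p\<close> divides \<open>Xy - Yx\<close>, it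
  divides both bases, and after division by \<open>p\<^sup>2\<close> there remains \<open>s\<^sup>2 + ab t\<^sup>2 = ab + 1\<close>, which for
  \<open>t \<noteq> 0\<close> forces \<open>s\<close> and \<open>t\<close> to be 1 or -1. The two linear equations for \<open>X\<close> and \<open>Y\<close> have
  determinant \<open>p\<close> up to sign, and solving them gives the stated values.
\<close>
lemma representation_of_multiple_core:
  fixes a b p x y X Y :: int
  assumes "prime p" and p: "p = a * x\<^sup>2 + b * y\<^sup>2" and "a > 0" "b > 0"
    and XY: "a * X\<^sup>2 + b * Y\<^sup>2 = (a * b + 1) * p"
    and ne: "X * y \<noteq> Y * x" and dvd: "p dvd X * y - Y * x"
  shows "(\<bar>X\<bar>, \<bar>Y\<bar>) \<in> {(\<bar>x - b * y\<bar>, \<bar>a * x + y\<bar>), (\<bar>x + b * y\<bar>, \<bar>a * x - y\<bar>)}"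
proof -
  have p0: "p \<noteq> 0" using \<open>prime p\<close> by auto
  obtain t where t: "X * y - Y * x = p * t" using dvd by (rule dvdE)
  have "(a * X * x + b * Y * y)\<^sup>2 + a * b * (X * y - Y * x)\<^sup>2
      = (a * X\<^sup>2 + b * Y\<^sup>2) * (a * x\<^sup>2 + b * y\<^sup>2)" by algebra
  then have "(a * X * x + b * Y * y)\<^sup>2 + a * b * (p * t)\<^sup>2 = (a * b + 1) * p * p"
    unfolding t XY p[symmetric] by simp
  then have sq: "(a * X * x + b * Y * y)\<^sup>2 = p\<^sup>2 * (a * b + 1 - a * b * t\<^sup>2)"
    by algebra
  then have "p\<^sup>2 dvd (a * X * x + b * Y * y)\<^sup>2" by simp
  then have "p dvd a * X * x + b * Y * y" by simp
  then obtain s where s: "a * X * x + b * Y * y = p * s" by (rule dvdE)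
  have s2: "s\<^sup>2 = a * b + 1 - a * b * t\<^sup>2"
    using sq p0 unfolding s by (simp add: power_mult_distrib)
  have "t \<noteq> 0" using t ne by auto
  have ab: "a * b \<ge> 1"
    using \<open>a > 0\<close> \<open>b > 0\<close> by (simp add: int_one_le_iff_zero_less)
  have "t\<^sup>2 \<le> 2"
  proof (rule ccontr)
    assume "\<not> t\<^sup>2 \<le> 2"
    then have "a * b * 3 \<le> a * b * t\<^sup>2" using ab by (intro mult_left_mono) auto
    then have "s\<^sup>2 < 0" using s2 ab by linarith
    then show False by simp
  qed
  then have "\<bar>t\<bar> < 2" using power2_le_iff_abs_le[of 2 t] abs_le_square_iff[of 2 t] by auto
  then have t1: "t = 1 \<or> t = -1" using \<open>t \<noteq> 0\<close> by linarith
  then have "s\<^sup>2 = 1" using s2 by auto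
  then have s1: "s = 1 \<or> s = -1" by (simp add: power2_eq_1_iff)
  have "p * X = x * (a * X * x + b * Y * y) + b * y * (X * y - Y * x)"
    unfolding p by algebra
  then have X: "X = x * s + b * y * t" using p0 unfolding s t by (simp add: algebra_simps) algebra
  have "p * Y = y * (a * X * x + b * Y * y) - a * x * (X * y - Y * x)"
    unfolding p by algebra
  then have Y: "Y = y * s - a * x * t" using p0 unfolding s t by (simp add: algebra_simps) algebra
  have "\<bar>X\<bar> = \<bar>x + b * y\<bar> \<and> \<bar>Y\<bar> = \<bar>a * x - y\<bar> \<or> \<bar>X\<bar> = \<bar>x - b * y\<bar> \<and> \<bar>Y\<bar> = \<bar>a * x + y\<bar>"
    unfolding abs_eq_iff using t1 s1 X Y by (elim disjE) simp_all
  then show ?thesis by auto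
qed

text \<open>
  Modulo \<open>p\<close> both \<open>(X, Y)\<close> and \<open>(x, y)\<close> are zeros of the form, so \<open>p\<close> divides
  \<open>a(X\<^sup>2y\<^sup>2 - Y\<^sup>2x\<^sup>2)\<close>. Being prime and not a divisor of \<open>a\<close>, it divides one of \<open>Xy - Yx\<close> and \<open>Xy + Yx\<close>; replacing \<open>Y\<close> by \<open>-Y\<close> reduces the second
  case to the first. Parity enters to exclude \<open>Xy = Yx\<close>: exactly one of these products is even.
\<close>
theorem representation_of_multiple:
  fixes a b p x y X Y :: int
  assumes "prime p" and p: "p = a * x\<^sup>2 + b * y\<^sup>2" and pos: "a > 0" "b > 0"
    and "p \<noteq> a" "p \<noteq> b" and "odd x \<noteq> odd y" and "odd X" "odd Y"
    and XY: "a * X\<^sup>2 + b * Y\<^sup>2 = (a * b + 1) * p"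
  shows "(\<bar>X\<bar>, \<bar>Y\<bar>) \<in> {(\<bar>x - b * y\<bar>, \<bar>a * x + y\<bar>), (\<bar>x + b * y\<bar>, \<bar>a * x - y\<bar>)}"
proof -
  have "a * ((X * y - Y * x) * (X * y + Y * x)) = p * (y\<^sup>2 * (a * b + 1) - Y\<^sup>2)"
    using XY p by algebra
  then have "p dvd a * ((X * y - Y * x) * (X * y + Y * x))" by simp
  moreover have "\<not> p dvd a" using prime_form_not_dvd(2) assms by blast
  ultimately have "p dvd X * y - Y * x \<or> p dvd X * y + Y * x"
    using \<open>prime p\<close> prime_dvd_multD by blast
  then show ?thesis
  proof
    assume "p dvd X * y - Y * x"
    moreover have "odd (X * y) \<noteq> odd (Y * x)" using assms by auto
    then have "X * y \<noteq> Y * x" by metis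
    ultimately show ?thesis using representation_of_multiple_core assms by blast
  next
    assume "p dvd X * y + Y * x"
    then have "p dvd X * y - (- Y) * x" by simp
    moreover have "odd (X * y) \<noteq> odd (- Y * x)" using assms by auto
    then have "X * y \<noteq> - Y * x" by metis
    moreover have "a * X\<^sup>2 + b * (- Y)\<^sup>2 = (a * b + 1) * p" using XY by simp
    ultimately show ?thesis using representation_of_multiple_core[of p a x b y X "- Y"] assms by simp
  qed
qed

lemma eight_triangular: "8 * int (Suc j choose 2) + 1 = (2 * int j + 1)\<^sup>2"
proof -
  have "2 * (Suc j choose 2) = Suc j * j" by (simp add: choose_two)
  then have "int (2 * (Suc j choose 2)) = int (Suc j * j)" by simp
  then have "2 * int (Suc j choose 2) = int j * (int j + 1)" by (simp add: algebra_simps)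
  then show ?thesis by (simp add: power2_eq_square algebra_simps)
qed

lemma mem_triangular_reps:
  "(j, k) \<in> triangular_reps a b n \<longleftrightarrow>
     int a * (2 * int j + 1)\<^sup>2 + int b * (2 * int k + 1)\<^sup>2 = 8 * int n + int a + int b"
proof -
  have "(j, k) \<in> triangular_reps a b n \<longleftrightarrow>
      int a * int (Suc j choose 2) + int b * int (Suc k choose 2) = int n"
    unfolding triangular_reps_def by (simp flip: of_nat_mult of_nat_add)
  then show ?thesis
    unfolding eight_triangular[symmetric] by (auto simp: algebra_simps)
qed

definition odd_index :: "int \<Rightarrow> nat" where
  "odd_index X = nat ((\<bar>X\<bar> - 1) div 2)"

lemma odd_index_eq:
  assumes "odd X"
  shows "2 * int (odd_index X) + 1 = \<bar>X\<bar>"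
  using assms unfolding odd_index_def by (cases "X \<ge> 0") (auto elim!: oddE, presburger?)

text \<open>
  The sign \<open>(-1)\<^sup>j\<close> makes the term independent of the sign of \<open>X\<close>: it equals \<open>\<chi>(X) X\<close> for the
  nontrivial character \<open>\<chi>\<close> modulo 4. The values \<open>x - by\<close>, \<open>ax + y\<close> etc. may thus be inserted without
  a distinction of signs.
\<close>
lemma odd_index_sign:
  assumes "odd X"
  shows "(-1) ^ odd_index X * (2 * int (odd_index X) + 1) = (if X mod 4 = 1 then X else - X)"
proof -
  define j where "j = odd_index X"
  have j: "\<bar>X\<bar> = 2 * int j + 1" using odd_index_eq[OF assms] by (simp add: j_def)
  show ?thesis
  proof (cases "even j")
    case True
    then obtain i where i: "j = 2 * i" by (rule evenE)
    show ?thesis using j unfolding j_def[symmetric] i by (cases "X \<ge> 0") (simp_all, presburger+)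
  next
    case False
    then obtain i where i: "j = 2 * i + 1" by (rule oddE)
    show ?thesis using j unfolding j_def[symmetric] i by (cases "X \<ge> 0") (simp_all, presburger+)
  qed
qed

lemma theta_term_odd_index:
  assumes "odd X" "odd Y"
  shows "theta_term (odd_index X, odd_index Y) = (if (X * Y) mod 4 = 1 then X * Y else - (X * Y))"
proof -
  have "theta_term (odd_index X, odd_index Y)
      = ((-1) ^ odd_index X * (2 * int (odd_index X) + 1)) * ((-1) ^ odd_index Y * (2 * int (odd_index Y) + 1))"
    by (simp add: theta_term_def power_add mult_ac)
  also have "\<dots> = (if X mod 4 = 1 then X else - X) * (if Y mod 4 = 1 then Y else - Y)"
    unfolding assms[THEN odd_index_sign] ..
  also have "\<dots> = (if (X * Y) mod 4 = 1 then X * Y else - (X * Y))"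
  proof -
    have "X mod 4 = 1 \<or> X mod 4 = 3" "Y mod 4 = 1 \<or> Y mod 4 = 3" using assms by presburger+
    moreover have "(X * Y) mod 4 = ((X mod 4) * (Y mod 4)) mod 4" by (simp add: mod_mult_eq)
    ultimately show ?thesis by auto
  qed
  finally show ?thesis .
qed

text \<open>
  The two products \<open>(x - by)(ax + y)\<close> and \<open>(x + by)(ax - y)\<close> differ by \<open>2xy(1 - ab)\<close>, a multiple of 8,
  and are both congruent to \<open>ax\<^sup>2 - by\<^sup>2\<close> modulo 4. They therefore carry the same sign, determined by
  \<open>-b\<close> if \<open>x\<close> is even and by \<open>a\<close> if \<open>x\<close> is odd.
\<close>
theorem sum_theta_term_prime:
  fixes a b p n :: nat and x y :: int
  assumes pos: "a > 0" "b > 0" and ab: "odd a" "odd b"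
    and "prime p" "odd p" "p \<noteq> a" "p \<noteq> b"
    and p: "int p = int a * x\<^sup>2 + int b * y\<^sup>2"
    and n: "8 * int n + int a + int b = (int a * int b + 1) * int p"
  shows "(\<Sum>r\<in>triangular_reps a b n. theta_term r)
       = (if even ((int a + int b) div 2 * x + (int b + 1) div 2) then 1 else -1)
         * (4 * int a * x\<^sup>2 - 2 * int p)"
proof -
  define A B where "A = int a" and "B = int b"
  have AB: "odd A" "odd B" "A > 0" "B > 0" using ab pos by (simp_all add: A_def B_def)
  have P: "prime (int p)" "int p \<noteq> A" "int p \<noteq> B" "odd (int p)"
    using \<open>prime p\<close> \<open>odd p\<close> \<open>p \<noteq> a\<close> \<open>p \<noteq> b\<close> by (simp_all add: A_def B_def)
  have p': "int p = A * x\<^sup>2 + B * y\<^sup>2" "int p = B * y\<^sup>2 + A * x\<^sup>2"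
    using p by (simp_all add: A_def B_def)
  have par: "odd x \<noteq> odd y" using P(4) AB unfolding p'(1) by auto
  have odds: "odd (x - B * y)" "odd (A * x + y)" "odd (x + B * y)" "odd (A * x - y)"
    using par AB by auto
  have x0: "x \<noteq> 0" using prime_form_not_dvd(1)[OF P(1) p'(1)] AB P by simp
  have y0: "y \<noteq> 0" using prime_form_not_dvd(1)[OF P(1) p'(2)] AB P by simp
  define u v where "u = (odd_index (x - B * y), odd_index (A * x + y))"
    and "v = (odd_index (x + B * y), odd_index (A * x - y))"
  have reps: "triangular_reps a b n = {u, v}"
  proof (intro set_eqI iffI)
    fix r assume "r \<in> {u, v}"
    moreover have "A * (x - B * y)\<^sup>2 + B * (A * x + y)\<^sup>2 = (A * B + 1) * int p"
      "A * (x + B * y)\<^sup>2 + B * (A * x - y)\<^sup>2 = (A * B + 1) * int p"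
      unfolding p' by algebra+
    ultimately show "r \<in> triangular_reps a b n"
      using n odds by (auto simp: u_def v_def mem_triangular_reps odd_index_eq A_def B_def)
  next
    fix r assume "r \<in> triangular_reps a b n"
    then obtain j k where r: "r = (j, k)"
      and "A * (2 * int j + 1)\<^sup>2 + B * (2 * int k + 1)\<^sup>2 = (A * B + 1) * int p"
      using n mem_triangular_reps by (cases r) (auto simp: A_def B_def)
    then have "(\<bar>2 * int j + 1\<bar>, \<bar>2 * int k + 1\<bar>) \<in>
        {(\<bar>x - B * y\<bar>, \<bar>A * x + y\<bar>), (\<bar>x + B * y\<bar>, \<bar>A * x - y\<bar>)}"
      using representation_of_multiple[OF P(1) p'(1) AB(3,4) P(2,3) par, of "2 * int j + 1" "2 * int k + 1"] by simp
    then show "r \<in> {u, v}"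
      unfolding odds[THEN odd_index_eq, symmetric] r u_def v_def by simp
  qed
  have "u \<noteq> v"
  proof
    assume "u = v"
    then have "odd_index (x - B * y) = odd_index (x + B * y)" by (simp add: u_def v_def)
    then have "\<bar>x - B * y\<bar> = \<bar>x + B * y\<bar>"
      using odd_index_eq[OF odds(1)] odd_index_eq[OF odds(3)] by simp
    then show False using x0 y0 AB by (auto simp: abs_eq_iff)
  qed
  then have "(\<Sum>r\<in>triangular_reps a b n. theta_term r) = theta_term u + theta_term v"
    by (simp add: reps)
  moreover
  define U V where "U = (x - B * y) * (A * x + y)" and "V = (x + B * y) * (A * x - y)"
  have UV: "U + V = 4 * A * x\<^sup>2 - 2 * int p" unfolding U_def V_def p' by algebra
  have "even (x * y)" "even (1 - A * B)" using par AB by auto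
  then have "2 * 2 dvd (x * y) * (1 - A * B)" by (rule mult_dvd_mono)
  then obtain w where w: "x * y * (1 - A * B) = 4 * w" by (auto elim: dvdE)
  have "U = A * x\<^sup>2 - B * y\<^sup>2 + 4 * w" unfolding w[symmetric] U_def by algebra
  then have U: "U mod 4 = (A * x\<^sup>2 - B * y\<^sup>2) mod 4" by (simp only: mod_mult_self2)
  have "V = A * x\<^sup>2 - B * y\<^sup>2 + 4 * (- w)"
    unfolding mult_minus_right w[symmetric] V_def by algebra
  then have V: "V mod 4 = (A * x\<^sup>2 - B * y\<^sup>2) mod 4" by (simp only: mod_mult_self2)
  obtain r where r: "A = 2 * r + 1" using AB(1) by (rule oddE)
  obtain s where s: "B = 2 * s + 1" using AB(2) by (rule oddE)
  have mod4: "(4 * m + (2 * l + 1)) mod 4 = 1 \<longleftrightarrow> even l"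
    for m l :: int by presburger
  have half: "(A + B) div 2 = r + s + 1" "(B + 1) div 2 = s + 1" unfolding r s by simp_all
  have sgn: "(A * x\<^sup>2 - B * y\<^sup>2) mod 4 = 1 \<longleftrightarrow> even ((A + B) div 2 * x + (B + 1) div 2)"
  proof (cases "even x")
    case True
    then obtain i where i: "x = 2 * i" by (rule evenE)
    have "odd y" using True par by simp
    then obtain l where l: "y = 2 * l + 1" by (rule oddE)
    have "A * x\<^sup>2 - B * y\<^sup>2 = 4 * (A * i\<^sup>2 - B * l\<^sup>2 - B * l) - B"
      unfolding i l by algebra
    also have "\<dots> = 4 * (A * i\<^sup>2 - B * l\<^sup>2 - B * l) + (2 * (- s - 1) + 1)"
      by (simp add: s)
    finally show ?thesis unfolding half using True by (simp only: mod4) simp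
  next
    case False
    then obtain i where i: "x = 2 * i + 1" by (rule oddE)
    have "even y" using False par by simp
    then obtain l where l: "y = 2 * l" by (rule evenE)
    have "A * x\<^sup>2 - B * y\<^sup>2 = 4 * (A * i\<^sup>2 + A * i - B * l\<^sup>2) + A"
      unfolding i l by algebra
    also have "\<dots> = 4 * (A * i\<^sup>2 + A * i - B * l\<^sup>2) + (2 * r + 1)"
      by (simp only: r)
    finally show ?thesis unfolding half using False by (simp only: mod4) auto
  qed
  have "theta_term u = (if (A * x\<^sup>2 - B * y\<^sup>2) mod 4 = 1 then U else - U)"
    unfolding u_def theta_term_odd_index[OF odds(1,2)] U_def[symmetric] U ..
  moreover have "theta_term v = (if (A * x\<^sup>2 - B * y\<^sup>2) mod 4 = 1 then V else - V)"
    unfolding v_def theta_term_odd_index[OF odds(3,4)] V_def[symmetric] V ..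
  ultimately show ?thesis unfolding sgn using UV by (simp add: A_def B_def)
qed

section \<open>The two evaluations of \<open>\<lambda>(a,b;n+1)\<close>\<close>

theorem lambda_coeff_eq_sum_tuples:
  assumes "a > 0" "b > 0"
  shows "(of_int (lambda_coeff a b (Suc n)) :: 'a::field_char_0)
    = (\<Sum>k\<in>weighted_tuples n. exp_term
        (\<lambda>m. -3 * of_nat (sigma_multiple a m + sigma_multiple b m)) n k)"
proof -
  have "weighted_tuples n = tuples_of_weight n n"
    by (simp only: weighted_tuples_def tuples_of_weight_def)
  then show ?thesis
    unfolding lambda_coeff_Suc[OF assms] eta_product_nth[OF assms order_refl, symmetric]
    by (simp only: eta_product_nth_eq_sum_exp_term[OF assms order_refl])
qed

theorem theorem3p1:
  fixes a b p n :: nat and x y :: int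
  assumes "a > 0" and "b > 0" and "\<not> 2 dvd a * b"
    and "prime p" and "odd p" and "p \<noteq> a" and "p \<noteq> b" and "\<not> p dvd a * b + 1"
    and "int p = int a * x\<^sup>2 + int b * y\<^sup>2"
    and "rat_of_nat n = ((of_nat a * of_nat b + 1) * of_nat p - of_nat a - of_nat b) / 8"
  shows "(-1) powi ((int a + int b) div 2 * x + (int b + 1) div 2)
           * (4 * rat_of_nat a * (rat_of_int x)\<^sup>2 - 2 * rat_of_nat p)
         = rat_of_int (lambda_coeff a b (n + 1))
       \<and> rat_of_int (lambda_coeff a b (n + 1))
         = (\<Sum>k\<in>weighted_tuples n.
              (-3) ^ (\<Sum>i=1..n. k i)
              * ((\<Prod>i=1..n.
                    (of_nat a * of_nat (sigma_rat (of_nat i / of_nat a))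
                     + of_nat b * of_nat (sigma_rat (of_nat i / of_nat b))) ^ k i)
                 / (\<Prod>i=1..n. of_nat i ^ k i * fact (k i))))"
proof
  have ab: "odd a" "odd b" using assms(3) by auto
  have "rat_of_int (8 * int n + int a + int b) = rat_of_int ((int a * int b + 1) * int p)"
    using assms(10) by (simp add: field_simps)
  then have "8 * int n + int a + int b = (int a * int b + 1) * int p"
    by (simp only: of_int_eq_iff)
  from sum_theta_term_prime[OF assms(1,2) ab assms(4-7) assms(9) this]
  have "lambda_coeff a b (n + 1)
      = (if even ((int a + int b) div 2 * x + (int b + 1) div 2) then 1 else -1)
        * (4 * int a * x\<^sup>2 - 2 * int p)"
    using lambda_coeff_Suc[OF assms(1,2)] by simp
  then show "(-1) powi ((int a + int b) div 2 * x + (int b + 1) div 2)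
      * (4 * rat_of_nat a * (rat_of_int x)\<^sup>2 - 2 * rat_of_nat p)
    = rat_of_int (lambda_coeff a b (n + 1))"
    by (simp add: power_int_minus_left)
next
  let ?s = "\<lambda>i. of_nat a * of_nat (sigma_rat (of_nat i / of_nat a))
    + of_nat b * of_nat (sigma_rat (of_nat i / of_nat b)) :: rat"
  have "exp_term (\<lambda>m. -3 * of_nat (sigma_multiple a m + sigma_multiple b m)) n k
      = (-3) ^ (\<Sum>i=1..n. k i)
        * ((\<Prod>i=1..n. ?s i ^ k i) / (\<Prod>i=1..n. of_nat i ^ k i * fact (k i)))" for k
  proof -
    have s: "-3 * of_nat (sigma_multiple a i + sigma_multiple b i) = -3 * ?s i" if "i \<in> {1..n}"
      for i
      using that by (simp add: sigma_multiple_eq assms)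
    have "exp_term (\<lambda>m. -3 * of_nat (sigma_multiple a m + sigma_multiple b m)) n k
        = (\<Prod>i=1..n. (-3) ^ k i * (?s i ^ k i / (of_nat i ^ k i * fact (k i))))"
      unfolding exp_term_def
      by (rule prod.cong) (simp_all only: s power_mult_distrib times_divide_eq_right)
    then show ?thesis by (simp only: prod.distrib prod_dividef power_sum)
  qed
  then show "rat_of_int (lambda_coeff a b (n + 1))
    = (\<Sum>k\<in>weighted_tuples n. (-3) ^ (\<Sum>i=1..n. k i)
        * ((\<Prod>i=1..n. ?s i ^ k i) / (\<Prod>i=1..n. of_nat i ^ k i * fact (k i))))"
    using lambda_coeff_eq_sum_tuples[OF assms(1,2), of n, where 'a = rat] by simp
qed

end
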